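(* The assignment $\mathcal T$ described in the context, sending a finite pointed set $\underline n_+=\{+,1,\dots,n\}$ to the category $\mathcal T(\underline n)$ of trees with leaves labeled by $\underline n$ and a pointed function $\varphi\colon\underline m_+\to\underline n_+$ to the grafting functor $\varphi^*\colon\mathcal T(\underline n)\to\mathcal T(\underline m)$, is an oplax functor $\mathcal T\colon \mathcal F_*^{\mathrm{op}}\to \mathrm{Cat}$ (with the structure maps $\tau$ of the context). The dendroidal category $\Omega$ is equivalent to the Grothendieck construction $\int_{\mathcal F_*^{\mathrm{op}}}\mathcal T$ of this oplax functor.
   Context: Trees. A tree is a finite (connected) graph with no cycles in which each end of an edge may or may not be attached to a vertex; an unattached end is a loose end. One loose end is chosen as the root; the other loose ends are the leaves. Trees are non-planar. The stick tree has one edge and no vertices; its edge carries both the root and the unique leaf. Leaves and root are identified with the edges carrying them. $E(T),V(T),\ell(T)$ denote the sets of edges, vertices, leaves. Each vertex has one outgoing edge (towards the root) and a possibly empty set of incoming edges; a vertex without incoming edges is a stump. A corolla is a tree with exactly one vertex. A subtree $S'$ of $S$ is a tree whose vertices and edges are subsets of those of $S$ such that if $v\in V(S')$ then all incoming edges of $v$ are in $S'$. The dendroidal category $\Omega$: objects are trees; a morphism $f\colon T\to S$ is a function $E(T)\to E(S)$ such that for each vertex $v$ of $T$ with outgoing edge $e_0$ and incoming edges $e_1,\dots,e_n$ there is a subtree of $S$ with root $f(e_0)$ and (exactly the $n$ distinct) leaves $f(e_1),\dots,f(e_n)$. Labeled trees. $\underline n=\{1,\dots,n\}$, $n\ge 0$.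 $\mathcal T(\underline n)$ has as objects pairs $(T,\chi_T)$ of a tree $T$ and a bijection $\chi_T\colon\underline n\to\ell(T)$, and as morphisms the morphisms $f\colon T\to S$ of $\Omega$ that send leaves to leaves, send the root to the root, and satisfy $f\circ\chi_T=\chi_S$. $\mathcal F_*$ is the category with objects $\underline n_+=\{+,1,\dots,n\}$ (basepoint $+$), $n\ge0$, and pointed functions. $\mathrm{Cat}$ is the 2-category of small categories, functors and natural transformations (size issues ignored). Oplax functors. For a small category $\mathcal A$, an oplax functor $(F,\tau)\colon\mathcal A^{\mathrm{op}}\to\mathrm{Cat}$ consists of categories $F(a)$; functors $F(f)\colon F(b)\to F(a)$ for $f\colon a\to b$; natural transformations $\tau_{f,g}\colon F(gf)\Rightarrow F(f)F(g)$ for $a\xrightarrow{f}b\xrightarrow{g}c$ and $\tau_a\colon F(\mathrm{id}_a)\Rightarrow\mathrm{id}_{F(a)}$; such that $(\tau_{f,g}F(h))\circ\tau_{gf,h}=(F(f)\tau_{g,h})\circ\tau_{f,hg}$ for composable $f,g,h$, and $(\tau_aF(f))\circ\tau_{\mathrm{id}_a,f}=\mathrm{id}=(F(f)\tau_b)\circ\tau_{f,\mathrm{id}_b}$ for $f\colon a\to b$. Grothendieck construction $\int_{\mathcal A^{\mathrm{op}}}F$: objects $(a,x)$ with $a\in\mathcal A$, $x\in F(a)$; a morphism $(a,x)\to(b,y)$ is a pair $(f,\alpha)$ with $f\colon b\to a$ in $\mathcal A$ and $\alpha\colon F(f)(x)\to y$ in $F(b)$; the composite of $(f,\alpha)\colon(a,x)\to(b,y)$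 and $(g,\beta)\colon(b,y)\to(c,z)$ is $(fg,\ \beta\circ F(g)(\alpha)\circ(\tau_{g,f})_x)$; the identity of $(a,x)$ is $(\mathrm{id}_a,(\tau_a)_x)$. The assignment $\mathcal T$. On objects $\underline n_+\mapsto\mathcal T(\underline n)$. For a pointed function $\varphi\colon\underline m_+\to\underline n_+$ and $T\in\mathcal T(\underline n)$, the tree $\varphi^*(T)\in\mathcal T(\underline m)$ is obtained from $T$ by grafting, onto the leaf labeled $i$ for each $i\in\underline n$, a corolla whose leaves are labeled by $\varphi^{-1}(i)$ (a stump if $\varphi^{-1}(i)=\varnothing$), and by grafting the root of $T$ onto a leaf of a further corolla whose other leaves are labeled by $\varphi^{-1}(+)\setminus\{+\}$ and whose root is the new root. For $f\colon T\to S$ in $\mathcal T(\underline n)$, $\varphi^*(f)$ acts as $f$ on edges of $T$, sends the new leaf $j$ to the new leaf $j$ for all $j\in\underline m$, and the new root to the new root. Structure maps: $(\tau_n)_T\colon\mathrm{id}_{\underline n_+}^*(T)\to T$ is the identity on edges of $T$ and sends the new leaf $i$ to the leaf $i$ of $T$ and the new root to the root of $T$. For $\underline l_+\xrightarrow{\gamma}\underline m_+\xrightarrow{\varphi}\underline n_+$, $(\tau_{\gamma,\varphi})_T\colon(\varphi\gamma)^*(T)\to\gamma^*\varphi^*(T)$ is the identity on edges of $T$, preserves the labels of the leaves, and sends root to root. *)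

theory Defs
  imports Main "HOL-Library.FuncSet"
begin

text \<open>
  A category is given by a set of objects and a family of hom-sets. The hom-sets need not be
  disjoint, so identities and composition carry the objects as arguments:
  \<open>Cmp C a b c g f\<close> is the composite of \<open>f : a \<rightarrow> b\<close> and \<open>g : b \<rightarrow> c\<close>.
\<close>

record ('o, 'm) cat =
  Obj :: "'o set"
  Hom :: "'o \<Rightarrow> 'o \<Rightarrow> 'm set"
  Idn :: "'o \<Rightarrow> 'm"
  Cmp :: "'o \<Rightarrow> 'o \<Rightarrow> 'o \<Rightarrow> 'm \<Rightarrow> 'm \<Rightarrow> 'm"

definition is_category :: "('o, 'm) cat \<Rightarrow> bool" where
  "is_category C \<longleftrightarrow>
     (\<forall>a \<in> Obj C. Idn C a \<in> Hom C a a) \<and>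
     (\<forall>a \<in> Obj C. \<forall>b \<in> Obj C. \<forall>c \<in> Obj C. \<forall>f \<in> Hom C a b. \<forall>g \<in> Hom C b c.
        Cmp C a b c g f \<in> Hom C a c) \<and>
     (\<forall>a \<in> Obj C. \<forall>b \<in> Obj C. \<forall>f \<in> Hom C a b.
        Cmp C a a b f (Idn C a) = f \<and> Cmp C a b b (Idn C b) f = f) \<and>
     (\<forall>a \<in> Obj C. \<forall>b \<in> Obj C. \<forall>c \<in> Obj C. \<forall>d \<in> Obj C.
        \<forall>f \<in> Hom C a b. \<forall>g \<in> Hom C b c. \<forall>h \<in> Hom C c d.
        Cmp C a c d h (Cmp C a b c g f) = Cmp C a b d (Cmp C b c d h g) f)"

definition is_iso :: "('o, 'm) cat \<Rightarrow> 'o \<Rightarrow> 'o \<Rightarrow> 'm \<Rightarrow> bool" where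
  "is_iso C a b f \<longleftrightarrow> f \<in> Hom C a b \<and>
     (\<exists>g \<in> Hom C b a. Cmp C a b a g f = Idn C a \<and> Cmp C b a b f g = Idn C b)"

record ('o, 'm, 'p, 'n) funct =
  OnOb :: "'o \<Rightarrow> 'p"
  OnHom :: "'o \<Rightarrow> 'o \<Rightarrow> 'm \<Rightarrow> 'n"

definition is_functor ::
    "('o, 'm) cat \<Rightarrow> ('p, 'n) cat \<Rightarrow> ('o, 'm, 'p, 'n) funct \<Rightarrow> bool" where
  "is_functor C D F \<longleftrightarrow> is_category C \<and> is_category D \<and>
     (\<forall>a \<in> Obj C. OnOb F a \<in> Obj D) \<and>
     (\<forall>a \<in> Obj C. \<forall>b \<in> Obj C. \<forall>f \<in> Hom C a b.
        OnHom F a b f \<in> Hom D (OnOb F a) (OnOb F b)) \<and>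
     (\<forall>a \<in> Obj C. OnHom F a a (Idn C a) = Idn D (OnOb F a)) \<and>
     (\<forall>a \<in> Obj C. \<forall>b \<in> Obj C. \<forall>c \<in> Obj C. \<forall>f \<in> Hom C a b. \<forall>g \<in> Hom C b c.
        OnHom F a c (Cmp C a b c g f) =
        Cmp D (OnOb F a) (OnOb F b) (OnOb F c) (OnHom F b c g) (OnHom F a b f))"

definition id_functor :: "('o, 'm, 'o, 'm) funct" where
  "id_functor = \<lparr>OnOb = (\<lambda>a. a), OnHom = (\<lambda>a b f. f)\<rparr>"

definition comp_functor ::
    "('p, 'n, 'q, 'k) funct \<Rightarrow> ('o, 'm, 'p, 'n) funct \<Rightarrow> ('o, 'm, 'q, 'k) funct" where
  "comp_functor G F =
     \<lparr>OnOb = (\<lambda>a. OnOb G (OnOb F a)),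
      OnHom = (\<lambda>a b f. OnHom G (OnOb F a) (OnOb F b) (OnHom F a b f))\<rparr>"

definition is_nat_trans ::
    "('o, 'm) cat \<Rightarrow> ('p, 'n) cat \<Rightarrow> ('o, 'm, 'p, 'n) funct \<Rightarrow> ('o, 'm, 'p, 'n) funct
      \<Rightarrow> ('o \<Rightarrow> 'n) \<Rightarrow> bool" where
  "is_nat_trans C D F G t \<longleftrightarrow> is_functor C D F \<and> is_functor C D G \<and>
     (\<forall>a \<in> Obj C. t a \<in> Hom D (OnOb F a) (OnOb G a)) \<and>
     (\<forall>a \<in> Obj C. \<forall>b \<in> Obj C. \<forall>f \<in> Hom C a b.
        Cmp D (OnOb F a) (OnOb F b) (OnOb G b) (t b) (OnHom F a b f) =
        Cmp D (OnOb F a) (OnOb G a) (OnOb G b) (OnHom G a b f) (t a))"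

definition is_nat_iso ::
    "('o, 'm) cat \<Rightarrow> ('p, 'n) cat \<Rightarrow> ('o, 'm, 'p, 'n) funct \<Rightarrow> ('o, 'm, 'p, 'n) funct
      \<Rightarrow> ('o \<Rightarrow> 'n) \<Rightarrow> bool" where
  "is_nat_iso C D F G t \<longleftrightarrow> is_nat_trans C D F G t \<and>
     (\<forall>a \<in> Obj C. is_iso D (OnOb F a) (OnOb G a) (t a))"

definition equivalent_categories :: "('o, 'm) cat \<Rightarrow> ('p, 'n) cat \<Rightarrow> bool" where
  "equivalent_categories C D \<longleftrightarrow>
     (\<exists>F G s t. is_functor C D F \<and> is_functor D C G \<and>
        is_nat_iso C C (comp_functor G F) id_functor s \<and>
        is_nat_iso D D (comp_functor F G) id_functor t)"

text \<open>
  Data of an oplax functor \<open>A\<^sup>o\<^sup>p \<rightarrow> Cat\<close>. For \<open>f : a \<rightarrow> b\<close> in \<open>A\<close>, \<open>Pull F a b f\<close> is the functor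
  \<open>F(f) : F(b) \<rightarrow> F(a)\<close>. For \<open>f : a \<rightarrow> b\<close> and \<open>g : b \<rightarrow> c\<close>, \<open>TauC F a b c f g\<close> is the transformation
  \<open>F(gf) \<Rightarrow> F(f) F(g)\<close>, and \<open>TauI F a\<close> is \<open>F(id a) \<Rightarrow> id\<close>.
\<close>

record ('a, 'f, 'o, 'm) oplax_data =
  Fib :: "'a \<Rightarrow> ('o, 'm) cat"
  Pull :: "'a \<Rightarrow> 'a \<Rightarrow> 'f \<Rightarrow> ('o, 'm, 'o, 'm) funct"
  TauC :: "'a \<Rightarrow> 'a \<Rightarrow> 'a \<Rightarrow> 'f \<Rightarrow> 'f \<Rightarrow> 'o \<Rightarrow> 'm"
  TauI :: "'a \<Rightarrow> 'o \<Rightarrow> 'm"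

text \<open>The equations between natural transformations are stated componentwise.\<close>

definition is_oplax_functor ::
    "('a, 'f) cat \<Rightarrow> ('a, 'f, 'o, 'm) oplax_data \<Rightarrow> bool" where
  "is_oplax_functor A F \<longleftrightarrow>
     is_category A \<and>
     (\<forall>a \<in> Obj A. is_category (Fib F a)) \<and>
     (\<forall>a \<in> Obj A. \<forall>b \<in> Obj A. \<forall>f \<in> Hom A a b.
        is_functor (Fib F b) (Fib F a) (Pull F a b f)) \<and>
     (\<forall>a \<in> Obj A. \<forall>b \<in> Obj A. \<forall>c \<in> Obj A. \<forall>f \<in> Hom A a b. \<forall>g \<in> Hom A b c.
        is_nat_trans (Fib F c) (Fib F a)
          (Pull F a c (Cmp A a b c g f))
          (comp_functor (Pull F a b f) (Pull F b c g))
          (TauC F a b c f g)) \<and>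
     (\<forall>a \<in> Obj A.
        is_nat_trans (Fib F a) (Fib F a) (Pull F a a (Idn A a)) id_functor (TauI F a)) \<and>
     (\<forall>a \<in> Obj A. \<forall>b \<in> Obj A. \<forall>c \<in> Obj A. \<forall>d \<in> Obj A.
        \<forall>f \<in> Hom A a b. \<forall>g \<in> Hom A b c. \<forall>h \<in> Hom A c d. \<forall>x \<in> Obj (Fib F d).
        (let gf = Cmp A a b c g f;
             hg = Cmp A b c d h g;
             hgf = Cmp A a b d hg f;
             Fh = OnOb (Pull F c d h) x;
             FgFh = OnOb (Pull F b c g) Fh;
             Fhg = OnOb (Pull F b d hg) x;
             Fhgf = OnOb (Pull F a d hgf) x
         in Cmp (Fib F a) Fhgf (OnOb (Pull F a c gf) Fh) (OnOb (Pull F a b f) FgFh)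
              (TauC F a b c f g Fh) (TauC F a c d gf h x) =
            Cmp (Fib F a) Fhgf (OnOb (Pull F a b f) Fhg) (OnOb (Pull F a b f) FgFh)
              (OnHom (Pull F a b f) Fhg FgFh (TauC F b c d g h x)) (TauC F a b d f hg x))) \<and>
     (\<forall>a \<in> Obj A. \<forall>b \<in> Obj A. \<forall>f \<in> Hom A a b. \<forall>x \<in> Obj (Fib F b).
        (let Ff = OnOb (Pull F a b f) x;
             Fidb = OnOb (Pull F b b (Idn A b)) x
         in Cmp (Fib F a) Ff (OnOb (Pull F a a (Idn A a)) Ff) Ff
              (TauI F a Ff) (TauC F a a b (Idn A a) f x) = Idn (Fib F a) Ff \<and>
            Cmp (Fib F a) Ff (OnOb (Pull F a b f) Fidb) Ff
              (OnHom (Pull F a b f) Fidb x (TauI F b x)) (TauC F a b b f (Idn A b) x)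
              = Idn (Fib F a) Ff))"

text \<open>
  A morphism \<open>(a, x) \<rightarrow> (b, y)\<close> is a pair of some \<open>f : b \<rightarrow> a\<close> in \<open>A\<close> and some
  \<open>\<alpha> : F(f)(x) \<rightarrow> y\<close> in \<open>F(b)\<close>.
\<close>

definition grothendieck ::
    "('a, 'f) cat \<Rightarrow> ('a, 'f, 'o, 'm) oplax_data \<Rightarrow> ('a \<times> 'o, 'f \<times> 'm) cat" where
  "grothendieck A F =
     \<lparr>Obj = {(a, x). a \<in> Obj A \<and> x \<in> Obj (Fib F a)},
      Hom = (\<lambda>(a, x) (b, y).
        {(f, \<alpha>). f \<in> Hom A b a \<and> \<alpha> \<in> Hom (Fib F b) (OnOb (Pull F b a f) x) y}),
      Idn = (\<lambda>(a, x). (Idn A a, TauI F a x)),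
      Cmp = (\<lambda>(a, x) (b, y) (c, z) (g, \<beta>) (f, \<alpha>).
        (let fg = Cmp A c b a f g;
             Ffgx = OnOb (Pull F c a fg) x;
             Ffx = OnOb (Pull F b a f) x;
             FgFfx = OnOb (Pull F c b g) Ffx;
             Fgy = OnOb (Pull F c b g) y
         in (fg,
             Cmp (Fib F c) Ffgx Fgy z
               \<beta>
               (Cmp (Fib F c) Ffgx FgFfx Fgy
                  (OnHom (Pull F c b g) Ffx y \<alpha>)
                  (TauC F c b a g f x)))))\<rparr>"

text \<open>
  A rooted graph whose edges are directed towards the root. Each edge has an upper and a lower end,
  and each end is attached to a vertex (\<open>Some v\<close>) or loose (\<open>None\<close>). The outgoing edge of a
  vertex has its upper end there, the incoming edges have their lower end there. In a connected
  graph without cycles the choice of the loose end serving as root determines the directions.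
\<close>

record ('e, 'v) rooted_graph =
  edges :: "'e set"
  verts :: "'v set"
  upper :: "'e \<Rightarrow> 'v option"
  lower :: "'e \<Rightarrow> 'v option"
  root_edge :: "'e"

definition attached :: "('e, 'v) rooted_graph \<Rightarrow> 'e \<Rightarrow> 'v \<Rightarrow> bool" where
  "attached T e v \<longleftrightarrow> upper T e = Some v \<or> lower T e = Some v"

definition joins :: "('e, 'v) rooted_graph \<Rightarrow> 'e \<Rightarrow> 'v \<Rightarrow> 'v \<Rightarrow> bool" where
  "joins T e v w \<longleftrightarrow>
     (upper T e = Some v \<and> lower T e = Some w) \<or> (upper T e = Some w \<and> lower T e = Some v)"

text \<open>
  In a tree every vertex is attached to some edge, so it suffices to connect the edges.
\<close>

definition connected_graph :: "('e, 'v) rooted_graph \<Rightarrow> bool" where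
  "connected_graph T \<longleftrightarrow>
     (\<forall>e \<in> edges T. \<forall>e' \<in> edges T.
        (e, e') \<in> {(a, b). a \<in> edges T \<and> b \<in> edges T \<and>
                           (\<exists>v \<in> verts T. attached T a v \<and> attached T b v)}\<^sup>*)"

text \<open>
  Cycles are undirected; loops and pairs of parallel edges are the cycles of length one and two.
\<close>

definition has_cycle :: "('e, 'v) rooted_graph \<Rightarrow> bool" where
  "has_cycle T \<longleftrightarrow>
     (\<exists>es vs. es \<noteq> [] \<and> length vs = length es \<and> distinct es \<and> distinct vs \<and>
        set es \<subseteq> edges T \<and> set vs \<subseteq> verts T \<and>
        (\<forall>i < length es. joins T (es ! i) (vs ! i) (vs ! (Suc i mod length es))))"

definition is_tree :: "('e, 'v) rooted_graph \<Rightarrow> bool" where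
  "is_tree T \<longleftrightarrow>
     finite (edges T) \<and> finite (verts T) \<and>
     (\<forall>e \<in> edges T. \<forall>v. attached T e v \<longrightarrow> v \<in> verts T) \<and>
     connected_graph T \<and> \<not> has_cycle T \<and>
     root_edge T \<in> edges T \<and>
     (\<forall>e \<in> edges T. lower T e = None \<longleftrightarrow> e = root_edge T) \<and>
     (\<forall>v \<in> verts T. \<exists>!e. e \<in> edges T \<and> upper T e = Some v)"

definition leaves :: "('e, 'v) rooted_graph \<Rightarrow> 'e set" where
  "leaves T = {e \<in> edges T. upper T e = None}"

definition outgoing :: "('e, 'v) rooted_graph \<Rightarrow> 'v \<Rightarrow> 'e" where
  "outgoing T v = (THE e. e \<in> edges T \<and> upper T e = Some v)"

definition incoming :: "('e, 'v) rooted_graph \<Rightarrow> 'v \<Rightarrow> 'e set" where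
  "incoming T v = {e \<in> edges T. lower T e = Some v}"

text \<open>
  The incidences of a subtree are those of the ambient tree; an end whose vertex is not in the
  subtree becomes loose.
\<close>

definition is_subtree :: "('e, 'v) rooted_graph \<Rightarrow> ('e, 'v) rooted_graph \<Rightarrow> bool" where
  "is_subtree S' S \<longleftrightarrow>
     is_tree S' \<and> edges S' \<subseteq> edges S \<and> verts S' \<subseteq> verts S \<and>
     (\<forall>e \<in> edges S'. \<forall>v \<in> verts S'.
        (upper S' e = Some v \<longleftrightarrow> upper S e = Some v) \<and>
        (lower S' e = Some v \<longleftrightarrow> lower S e = Some v)) \<and>
     (\<forall>v \<in> verts S'. incoming S v \<subseteq> edges S')"

definition dend_hom ::
    "('e, 'v) rooted_graph \<Rightarrow> ('e, 'v) rooted_graph \<Rightarrow> ('e \<Rightarrow> 'e) set" where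
  "dend_hom T S =
     {f \<in> edges T \<rightarrow>\<^sub>E edges S. \<forall>v \<in> verts T. \<exists>S'.
        is_subtree S' S \<and> root_edge S' = f (outgoing T v) \<and>
        inj_on f (incoming T v) \<and> leaves S' = f ` incoming T v}"

definition Omega :: "(('e, 'v) rooted_graph, 'e \<Rightarrow> 'e) cat" where
  "Omega =
     \<lparr>Obj = {T. is_tree T},
      Hom = dend_hom,
      Idn = (\<lambda>T. restrict (\<lambda>e. e) (edges T)),
      Cmp = (\<lambda>T S R g f. compose (edges T) g f)\<rparr>"

type_synonym ('e, 'v) labeled_graph = "('e, 'v) rooted_graph \<times> (nat \<Rightarrow> 'e)"

definition labeled_hom ::
    "nat \<Rightarrow> ('e, 'v) labeled_graph \<Rightarrow> ('e, 'v) labeled_graph \<Rightarrow> ('e \<Rightarrow> 'e) set" where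
  "labeled_hom n = (\<lambda>(T, \<chi>T) (S, \<chi>S).
     {f \<in> dend_hom T S. f ` leaves T \<subseteq> leaves S \<and> f (root_edge T) = root_edge S \<and>
        (\<forall>i \<in> {1..n}. f (\<chi>T i) = \<chi>S i)})"

definition labeled_trees :: "nat \<Rightarrow> (('e, 'v) labeled_graph, 'e \<Rightarrow> 'e) cat" where
  "labeled_trees n =
     \<lparr>Obj = {(T, \<chi>). is_tree T \<and> \<chi> \<in> extensional {1..n} \<and> bij_betw \<chi> {1..n} (leaves T)},
      Hom = labeled_hom n,
      Idn = (\<lambda>(T, \<chi>). restrict (\<lambda>e. e) (edges T)),
      Cmp = (\<lambda>(T, _) _ _ g f. compose (edges T) g f)\<rparr>"

text \<open>The pointed set \<open>{+, 1, \<dots>, n}\<close>, with \<open>None\<close> as the base point \<open>+\<close>.\<close>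

definition pset :: "nat \<Rightarrow> nat option set" where
  "pset n = insert None (Some ` {1..n})"

definition Fin_pt :: "(nat, nat option \<Rightarrow> nat option) cat" where
  "Fin_pt =
     \<lparr>Obj = UNIV,
      Hom = (\<lambda>m n. {\<phi> \<in> pset m \<rightarrow>\<^sub>E pset n. \<phi> None = None}),
      Idn = (\<lambda>n. restrict (\<lambda>i. i) (pset n)),
      Cmp = (\<lambda>l m n \<psi> \<phi>. compose (pset l) \<psi> \<phi>)\<rparr>"

text \<open>
  Edges and vertices of all trees are taken from a fixed infinite supply of names, which is closed
  under the disjoint unions needed for grafting. The parameter \<open>'a\<close> is an arbitrary type of atomic
  names. In a grafted tree, \<open>Old x\<close> is the edge or vertex \<open>x\<close> of the original tree. The edges
  \<open>New j\<close> are the new leaves, while the vertex \<open>New i\<close> is that of the corolla grafted onto the leaf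
  labeled \<open>i\<close>. \<open>NewRoot\<close> is the new root and also the vertex of the corolla at the bottom.
\<close>

datatype 'a name = Atom 'a | Old "'a name" | New nat | NewRoot

type_synonym 'a ngraph = "('a name, 'a name) rooted_graph"
type_synonym 'a lgraph = "('a name, 'a name) labeled_graph"

definition graft_upper :: "nat \<Rightarrow> 'a lgraph \<Rightarrow> 'a name \<Rightarrow> 'a name option" where
  "graft_upper n = (\<lambda>(T, \<chi>) x. case x of
       Old e \<Rightarrow> (case upper T e of Some v \<Rightarrow> Some (Old v)
                                | None \<Rightarrow> Some (New (inv_into {1..n} \<chi> e)))
     | New j \<Rightarrow> None
     | NewRoot \<Rightarrow> Some NewRoot
     | Atom a \<Rightarrow> None)"

definition graft_lower ::
    "(nat option \<Rightarrow> nat option) \<Rightarrow> 'a lgraph \<Rightarrow> 'a name \<Rightarrow> 'a name option" where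
  "graft_lower \<phi> = (\<lambda>(T, \<chi>) x. case x of
       Old e \<Rightarrow> (if e = root_edge T then Some NewRoot else map_option Old (lower T e))
     | New j \<Rightarrow> (case \<phi> (Some j) of Some i \<Rightarrow> Some (New i) | None \<Rightarrow> Some NewRoot)
     | NewRoot \<Rightarrow> None
     | Atom a \<Rightarrow> None)"

definition graft ::
    "nat \<Rightarrow> nat \<Rightarrow> (nat option \<Rightarrow> nat option) \<Rightarrow> 'a lgraph \<Rightarrow> 'a lgraph" where
  "graft m n \<phi> = (\<lambda>(T, \<chi>).
     (\<lparr>edges = Old ` edges T \<union> New ` {1..m} \<union> {NewRoot},
       verts = Old ` verts T \<union> New ` {1..n} \<union> {NewRoot},
       upper = graft_upper n (T, \<chi>),
       lower = graft_lower \<phi> (T, \<chi>),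
       root_edge = NewRoot\<rparr>,
      restrict New {1..m}))"

definition graft_map ::
    "nat \<Rightarrow> nat \<Rightarrow> (nat option \<Rightarrow> nat option) \<Rightarrow> 'a lgraph \<Rightarrow> ('a name \<Rightarrow> 'a name)
      \<Rightarrow> ('a name \<Rightarrow> 'a name)" where
  "graft_map m n \<phi> X f = restrict
     (\<lambda>x. case x of Old e \<Rightarrow> Old (f e) | New j \<Rightarrow> New j | NewRoot \<Rightarrow> NewRoot | Atom a \<Rightarrow> Atom a)
     (edges (fst (graft m n \<phi> X)))"

definition graft_functor ::
    "nat \<Rightarrow> nat \<Rightarrow> (nat option \<Rightarrow> nat option)
      \<Rightarrow> ('a lgraph, 'a name \<Rightarrow> 'a name, 'a lgraph, 'a name \<Rightarrow> 'a name) funct" where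
  "graft_functor m n \<phi> = \<lparr>OnOb = graft m n \<phi>, OnHom = (\<lambda>X Y f. graft_map m n \<phi> X f)\<rparr>"

definition tau_unit :: "nat \<Rightarrow> 'a lgraph \<Rightarrow> 'a name \<Rightarrow> 'a name" where
  "tau_unit n = (\<lambda>(T, \<chi>). restrict
     (\<lambda>x. case x of Old e \<Rightarrow> e | New i \<Rightarrow> \<chi> i | NewRoot \<Rightarrow> root_edge T | Atom a \<Rightarrow> Atom a)
     (edges (fst (graft n n (Idn Fin_pt n) (T, \<chi>)))))"

definition tau_comp ::
    "nat \<Rightarrow> nat \<Rightarrow> nat \<Rightarrow> (nat option \<Rightarrow> nat option) \<Rightarrow> (nat option \<Rightarrow> nat option)
      \<Rightarrow> 'a lgraph \<Rightarrow> 'a name \<Rightarrow> 'a name" where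
  "tau_comp l m n \<gamma> \<phi> X = restrict
     (\<lambda>x. case x of Old e \<Rightarrow> Old (Old e) | New j \<Rightarrow> New j | NewRoot \<Rightarrow> NewRoot | Atom a \<Rightarrow> Atom a)
     (edges (fst (graft l n (Cmp Fin_pt l m n \<phi> \<gamma>) X)))"

definition tree_oplax ::
    "(nat, nat option \<Rightarrow> nat option, 'a lgraph, 'a name \<Rightarrow> 'a name) oplax_data" where
  "tree_oplax =
     \<lparr>Fib = labeled_trees,
      Pull = graft_functor,
      TauC = tau_comp,
      TauI = tau_unit\<rparr>"

end

theory Submission
  imports Defs
begin

text \<open>
  The edges of a tree are ordered by \<open>below\<close>, with the root at the bottom. A subtree of \<open>S\<close>
  with root \<open>r\<close> and leaves \<open>L\<close> exists iff \<open>L\<close> is an antichain above \<open>r\<close> such that each leaf of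
  \<open>S\<close> above \<open>r\<close> lies above an element of \<open>L\<close>; call this \<open>cover S r L\<close>. So a morphism is a map of
  edges sending the inputs of a vertex injectively onto a cover of the image of its output. Such
  maps preserve covers, preserve the order, and send incomparable edges to incomparable ones.

  A morphism \<open>(n, X) \<rightarrow> (m, Y)\<close> of the Grothendieck construction is a pair \<open>(\<phi>, \<alpha>)\<close> with
  \<open>\<alpha> : \<phi>\<^sup>*X \<rightarrow> Y\<close>, and restricting \<open>\<alpha>\<close> to the edges of \<open>X\<close> gives a functor to \<open>Omega\<close>. It is fully
  faithful: \<open>\<phi>\<close> is recovered from the restriction \<open>f\<close> by letting \<open>\<phi> j = i\<close> iff the leaf \<open>j\<close> of \<open>Y\<close>
  is above the image under \<open>f\<close> of the leaf \<open>i\<close> of \<open>X\<close>, and \<open>\<alpha>\<close> is determined on the new edges by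
  the labels. It is surjective on objects since every finite set of leaves can be labeled.
\<close>

section \<open>Trees by depth functions\<close>

lemma finite_has_max_measure:
  fixes f :: "'b \<Rightarrow> nat"
  assumes "finite A" "A \<noteq> {}"
  obtains m where "m \<in> A" "\<And>x. x \<in> A \<Longrightarrow> f x \<le> f m"
proof -
  have "Max (f ` A) \<in> f ` A" using assms by (intro Max_in) auto
  then obtain m where m: "m \<in> A" "f m = Max (f ` A)" by auto
  have "f x \<le> f m" if "x \<in> A" for x using that assms m by simp
  with m that show thesis by blast
qed

text \<open>A shortest directed cycle repeats no vertex, since a repetition would cut out a shorter
  one. Its edges are then distinct as well, having distinct upper ends, so it is an undirected cycle
  in the sense of \<open>has_cycle\<close>.\<close>

lemma acyclic_if_no_cycle:
  assumes "\<not> has_cycle T" "\<forall>e \<in> edges T. \<forall>v. attached T e v \<longrightarrow> v \<in> verts T"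
  shows "acyclic {(v, w). \<exists>e \<in> edges T. upper T e = Some v \<and> lower T e = Some w}" (is "acyclic ?R")
proof (rule ccontr)
  assume "\<not> acyclic ?R"
  then obtain v0 where "(v0, v0) \<in> ?R\<^sup>+" by (auto simp: acyclic_def)
  then have ex: "\<exists>n. n > 0 \<and> (\<exists>v. (v, v) \<in> ?R ^^ n)" by (auto simp: trancl_power)
  define n where "n = (LEAST n. n > 0 \<and> (\<exists>v. (v, v) \<in> ?R ^^ n))"
  have n: "n > 0" "\<exists>v. (v, v) \<in> ?R ^^ n" using LeastI_ex[OF ex] by (auto simp: n_def)
  have least: "m > 0 \<Longrightarrow> (v, v) \<in> ?R ^^ m \<Longrightarrow> n \<le> m" for m v
    unfolding n_def by (rule Least_le) auto
  from n obtain v where "(v, v) \<in> ?R ^^ n" by auto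
  then obtain f where f: "f 0 = v" "f n = v" "\<forall>i<n. (f i, f (Suc i)) \<in> ?R"
    by (auto simp only: relpow_fun_conv)
  have "\<forall>i<n. \<exists>e. e \<in> edges T \<and> upper T e = Some (f i) \<and> lower T e = Some (f (Suc i))"
    using f(3) by auto
  then obtain e where e: "\<And>i. i < n \<Longrightarrow> e i \<in> edges T \<and> upper T (e i) = Some (f i) \<and> lower T (e i) = Some (f (Suc i))"
    by metis
  have neq: "f i \<noteq> f j" if "i < j" "j < n" for i j
  proof
    assume eq: "f i = f j"
    have "(f i, f i) \<in> ?R ^^ (j - i)"
      unfolding relpow_fun_conv
      by (rule exI[of _ "\<lambda>k. f (i + k)"]) (use that eq f(3) in auto)
    from least[OF _ this] that show False by auto
  qed
  have injf: "inj_on f {..<n}" 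
    by (rule inj_onI) (metis neq lessThan_iff linorder_neqE_nat)
  have inje: "inj_on e {..<n}"
    by (rule inj_onI) (metis e injf inj_onD lessThan_iff option.inject)
  have "has_cycle T" unfolding has_cycle_def
  proof (intro exI conjI)
    let ?es = "map e [0..<n]" and ?vs = "map f [0..<n]"
    show "?es \<noteq> []" using n by simp
    show "length ?vs = length ?es" by simp
    show "distinct ?es" "distinct ?vs"
      using injf inje by (auto simp: distinct_map lessThan_atLeast0)
    show "set ?es \<subseteq> edges T" using e by auto
    have "f i \<in> verts T" if "i < n" for i
      using e[OF that] assms(2) unfolding attached_def by blast
    then show "set ?vs \<subseteq> verts T" by auto
    show "\<forall>i<length ?es. joins T (?es ! i) (?vs ! i) (?vs ! (Suc i mod length ?es))"
    proof (intro allI impI)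
      fix i assume i: "i < length ?es"
      \<comment> \<open>Only the last index wraps around, and there
        \<open>f n = f 0\<close>.\<close>
      have "f (Suc i mod n) = f (Suc i)"
        using f i by (cases "Suc i = n") auto
      then show "joins T (?es ! i) (?vs ! i) (?vs ! (Suc i mod length ?es))"
        using e[of i] i by (auto simp: joins_def)
    qed
  qed
  with assms show False by simp
qed

text \<open>The depth of a vertex is the number of vertices reachable from it by a nonempty
  descending path. Acyclicity makes this number drop strictly along an edge. Such a function is the
  working substitute for the absence of cycles.\<close>

lemma tree_depth:
  fixes T :: "('e, 'v) rooted_graph"
  assumes "is_tree T"
  obtains d :: "'v \<Rightarrow> nat" where
    "\<And>e v w. e \<in> edges T \<Longrightarrow> upper T e = Some v \<Longrightarrow> lower T e = Some w \<Longrightarrow> d w < d v"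
proof -
  let ?R = "{(v, w). \<exists>e \<in> edges T. upper T e = Some v \<and> lower T e = Some w}"
  have ac: "acyclic ?R" using assms acyclic_if_no_cycle unfolding is_tree_def by blast
  have "?R \<subseteq> verts T \<times> verts T"
    using assms unfolding is_tree_def attached_def by blast
  moreover have "finite (verts T)" using assms by (simp add: is_tree_def)
  ultimately have fin: "finite (?R\<^sup>+)" by (meson finite_SigmaI finite_subset finite_trancl)
  have "card (?R\<^sup>+ `` {w}) < card (?R\<^sup>+ `` {v})"
    if "e \<in> edges T" "upper T e = Some v" "lower T e = Some w" for e v w
  proof (rule psubset_card_mono)
    show "finite (?R\<^sup>+ `` {v})" using fin by (simp add: finite_Image)
    have vw: "(v, w) \<in> ?R" using that by auto
    then have "?R\<^sup>+ `` {w} \<subseteq> ?R\<^sup>+ `` {v}" by (auto intro: trancl_into_trancl2)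
    moreover have "w \<in> ?R\<^sup>+ `` {v}" using vw by blast
    moreover have "w \<notin> ?R\<^sup>+ `` {w}" using ac by (auto simp: acyclic_def)
    ultimately show "?R\<^sup>+ `` {w} \<subset> ?R\<^sup>+ `` {v}" by blast
  qed
  with that show ?thesis .
qed

text \<open>At a deepest vertex of a cycle, both neighbouring edges of the cycle must have their
  upper end there, so they coincide by uniqueness of the outgoing edge. The cycle is then a loop,
  which contradicts the strict decrease of depth.\<close>

lemma no_cycle_if_depth:
  fixes d :: "'v \<Rightarrow> nat"
  assumes depth: "\<And>e v w. e \<in> edges T \<Longrightarrow> upper T e = Some v \<Longrightarrow> lower T e = Some w \<Longrightarrow> d w < d v"
    and unique: "\<forall>v \<in> verts T. \<exists>!e. e \<in> edges T \<and> upper T e = Some v"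
  shows "\<not> has_cycle T"
proof
  assume "has_cycle T"
  then obtain es vs where c: "es \<noteq> []" "length vs = length es" "distinct es" "distinct vs"
    "set es \<subseteq> edges T" "set vs \<subseteq> verts T"
    "\<forall>i < length es. joins T (es ! i) (vs ! i) (vs ! (Suc i mod length es))"
    unfolding has_cycle_def by blast
  let ?n = "length es"
  have n: "?n > 0" using c by auto
  have "vs \<noteq> []" using c by auto
  then obtain v where v: "v \<in> set vs" "\<And>w. w \<in> set vs \<Longrightarrow> d w \<le> d v"
    using finite_has_max_measure[of "set vs" d] by auto
  then obtain k where k: "k < ?n" "vs ! k = v" using c by (metis in_set_conv_nth)
  \<comment> \<open>The cyclic predecessor of \<open>k\<close>, so that the edges
    \<open>es ! p\<close> and \<open>es ! k\<close> are the two meeting at \<open>v\<close>.\<close>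
  define p where "p = (if k = 0 then ?n - 1 else k - 1)"
  have p: "p < ?n" "Suc p mod ?n = k" using k n by (auto simp: p_def)
  have up: "upper T e = Some v" if "e \<in> set es" "w \<in> set vs" "joins T e v w" for e w
    using that depth[of e w v] v(2) c(5) by (force simp: joins_def)
  have ek: "joins T (es ! k) v (vs ! (Suc k mod ?n))" using c(7) k by auto
  have ep: "joins T (es ! p) v (vs ! p)" using c(7) k p by (metis joins_def)
  have "upper T (es ! k) = Some v" "upper T (es ! p) = Some v"
    using up[OF _ _ ek] up[OF _ _ ep] c(2) k p n by auto
  then have "es ! k = es ! p" using unique v c(5,6) k p by (metis nth_mem subsetD)
  then have "k = p" using c(3) k p by (simp add: nth_eq_iff_index_eq)
  then have "joins T (es ! k) v v" using ep k by simp
  moreover have "es ! k \<in> edges T" using c(5) k by auto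
  ultimately show False using depth[of "es ! k" v v] by (auto simp: joins_def)
qed

text \<open>From any edge one can descend to the root: the outgoing edge of the lower vertex is
  adjacent and ends at smaller depth. Adjacency is symmetric, so any two edges are connected through
  the root.\<close>

lemma connected_if_depth:
  fixes d :: "'v \<Rightarrow> nat"
  assumes depth: "\<And>e v w. e \<in> edges T \<Longrightarrow> upper T e = Some v \<Longrightarrow> lower T e = Some w \<Longrightarrow> d w < d v"
    and unique: "\<forall>v \<in> verts T. \<exists>!e. e \<in> edges T \<and> upper T e = Some v"
    and att: "\<forall>e \<in> edges T. \<forall>v. attached T e v \<longrightarrow> v \<in> verts T"
    and root: "\<forall>e \<in> edges T. lower T e = None \<longleftrightarrow> e = root_edge T"
  shows "connected_graph T"
proof -
  let ?A = "{(a, b). a \<in> edges T \<and> b \<in> edges T \<and> (\<exists>v \<in> verts T. attached T a v \<and> attached T b v)}"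
  have down: "(e, root_edge T) \<in> ?A\<^sup>*"
    if "e \<in> edges T" "case lower T e of None \<Rightarrow> 0 = k | Some v \<Rightarrow> Suc (d v) = k" for e k
    using that
  proof (induction k arbitrary: e rule: less_induct)
    case (less k)
    show ?case
    proof (cases "lower T e")
      case None
      then show ?thesis using root less.prems by auto
    next
      case (Some v)
      then have v: "v \<in> verts T" using att less.prems by (auto simp: attached_def)
      then obtain a where a: "a \<in> edges T" "upper T a = Some v" using unique by blast
      have "(e, a) \<in> ?A" using a v Some less.prems by (auto simp: attached_def)
      moreover have "(a, root_edge T) \<in> ?A\<^sup>*"
      proof (cases "lower T a")
        case None
        then show ?thesis using root a by auto
      next
        case (Some w)
        show ?thesis
          by (rule less.IH[of "Suc (d w)"])
            (use depth[OF a Some] less.prems Some a \<open>lower T e = _\<close> in auto)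
      qed
      ultimately show ?thesis by (rule converse_rtrancl_into_rtrancl)
    qed
  qed
  have "sym ?A" by (auto simp: sym_def)
  then have "sym (?A\<^sup>*)" by (rule sym_rtrancl)
  have "(e, e') \<in> ?A\<^sup>*" if "e \<in> edges T" "e' \<in> edges T" for e e'
  proof -
    have "(e, root_edge T) \<in> ?A\<^sup>*" "(e', root_edge T) \<in> ?A\<^sup>*"
      using down[of e "case lower T e of None \<Rightarrow> 0 | Some v \<Rightarrow> Suc (d v)"]
        down[of e' "case lower T e' of None \<Rightarrow> 0 | Some v \<Rightarrow> Suc (d v)"] that
      by (simp_all split: option.splits)
    then show ?thesis using \<open>sym (?A\<^sup>*)\<close> by (meson rtrancl_trans symE)
  qed
  then show ?thesis unfolding connected_graph_def by blast
qed

text \<open>Connectedness and the absence of cycles are replaced by one depth function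
  \<open>d\<close>. All trees built later, subtrees and graftings, are recognized this way.\<close>

lemma is_treeI:
  fixes d :: "'v \<Rightarrow> nat"
  assumes "finite (edges T)" "finite (verts T)" "root_edge T \<in> edges T"
    and "\<And>e v. e \<in> edges T \<Longrightarrow> upper T e = Some v \<Longrightarrow> v \<in> verts T"
    and "\<And>e v. e \<in> edges T \<Longrightarrow> lower T e = Some v \<Longrightarrow> v \<in> verts T"
    and "\<And>e. e \<in> edges T \<Longrightarrow> lower T e = None \<longleftrightarrow> e = root_edge T"
    and "\<And>v. v \<in> verts T \<Longrightarrow> \<exists>!e. e \<in> edges T \<and> upper T e = Some v"
    and "\<And>e v w. e \<in> edges T \<Longrightarrow> upper T e = Some v \<Longrightarrow> lower T e = Some w \<Longrightarrow> d w < d v"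
  shows "is_tree T"
proof -
  have att: "\<forall>e \<in> edges T. \<forall>v. attached T e v \<longrightarrow> v \<in> verts T"
    using assms(4,5) by (auto simp: attached_def)
  have "connected_graph T" using connected_if_depth[of T d] assms att by auto
  moreover have "\<not> has_cycle T" using no_cycle_if_depth[of T d] assms by blast
  ultimately show ?thesis
    unfolding is_tree_def by (intro conjI ballI) (use assms att in \<open>simp_all\<close>)
qed

section \<open>The order on the edges of a tree\<close>

definition child :: "('e, 'v) rooted_graph \<Rightarrow> 'e \<Rightarrow> 'e \<Rightarrow> bool" where
  "child T a b \<longleftrightarrow> a \<in> edges T \<and> b \<in> edges T \<and> (\<exists>v. upper T a = Some v \<and> lower T b = Some v)"

abbreviation below :: "('e, 'v) rooted_graph \<Rightarrow> 'e \<Rightarrow> 'e \<Rightarrow> bool" where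
  "below T \<equiv> (child T)\<^sup>*\<^sup>*"

text \<open>Being a reflexive closure, \<open>below T a a\<close> holds even if \<open>a\<close> is
  no edge, so membership can only be transferred from one side to the other.\<close>

lemma below_edges:
  assumes "below T a b"
  shows "a \<in> edges T \<longleftrightarrow> b \<in> edges T"
  using assms by (induction) (auto simp: child_def)

lemma tree_root: "is_tree T \<Longrightarrow> root_edge T \<in> edges T"
  by (simp add: is_tree_def)

lemma tree_upper_vert: "is_tree T \<Longrightarrow> e \<in> edges T \<Longrightarrow> upper T e = Some v \<Longrightarrow> v \<in> verts T"
  and tree_lower_vert: "is_tree T \<Longrightarrow> e \<in> edges T \<Longrightarrow> lower T e = Some v \<Longrightarrow> v \<in> verts T"
  by (auto simp: is_tree_def attached_def)

lemma tree_lower_None: "is_tree T \<Longrightarrow> e \<in> edges T \<Longrightarrow> lower T e = None \<longleftrightarrow> e = root_edge T"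
  by (simp add: is_tree_def)

lemma tree_upper_unique:
  "is_tree T \<Longrightarrow> a \<in> edges T \<Longrightarrow> b \<in> edges T \<Longrightarrow> upper T a = Some v \<Longrightarrow> upper T b = Some v \<Longrightarrow> a = b"
  by (metis is_tree_def tree_upper_vert)

lemma outgoing_eq: "is_tree T \<Longrightarrow> e \<in> edges T \<Longrightarrow> upper T e = Some v \<Longrightarrow> outgoing T v = e"
  unfolding outgoing_def by (rule the_equality) (auto intro: tree_upper_unique)

lemma outgoing:
  assumes "is_tree T" "v \<in> verts T"
  shows "outgoing T v \<in> edges T" "upper T (outgoing T v) = Some v"
proof -
  have "\<exists>e. e \<in> edges T \<and> upper T e = Some v" using assms by (auto simp: is_tree_def)
  then show "outgoing T v \<in> edges T" "upper T (outgoing T v) = Some v"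
    using outgoing_eq assms by metis+
qed

lemma child_incoming:
  assumes "is_tree T" "a \<in> edges T" "upper T a = Some v"
  shows "child T a b \<longleftrightarrow> b \<in> incoming T v"
  using assms by (auto simp: child_def incoming_def)

text \<open>Carries the depth over to edges: 0 for the root, otherwise one more than the depth of
  the lower vertex. It serves for antisymmetry, for descending to the root and for choosing topmost
  edges.\<close>

lemma tree_height:
  fixes T :: "('e, 'v) rooted_graph"
  assumes "is_tree T"
  obtains h :: "'e \<Rightarrow> nat" where "\<And>a b. child T a b \<Longrightarrow> h a < h b"
proof -
  obtain d :: "'v \<Rightarrow> nat" where d:
    "\<And>e v w. e \<in> edges T \<Longrightarrow> upper T e = Some v \<Longrightarrow> lower T e = Some w \<Longrightarrow> d w < d v"
    using tree_depth assms by blast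
  show thesis
    by (rule that[of "\<lambda>e. case lower T e of None \<Rightarrow> 0 | Some v \<Rightarrow> Suc (d v)"])
      (auto simp: child_def d split: option.split)
qed

lemma child_below_antisym:
  fixes T :: "('e, 'v) rooted_graph"
  assumes "is_tree T" "child T a b" "below T b a"
  shows False
proof -
  obtain h :: "'e \<Rightarrow> nat" where h: "\<And>a b. child T a b \<Longrightarrow> h a < h b"
    using tree_height assms by blast
  have "h b \<le> h a" using assms(3) by induction (auto dest: h)
  with h assms show False by fastforce
qed

lemma below_antisym:
  assumes "is_tree T" "below T a b" "below T b a"
  shows "a = b"
  using assms(2)
proof (cases rule: converse_rtranclpE)
  case (step y)
  then show ?thesis
    using child_below_antisym[OF assms(1) step(1)] assms(3) by (meson rtranclp_trans)
qed simp

lemma child_unique: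
  "is_tree T \<Longrightarrow> child T a c \<Longrightarrow> child T b c \<Longrightarrow> a = b"
  by (auto simp: child_def intro: tree_upper_unique)

lemma below_childD:
  assumes "is_tree T" "below T a c" "child T b c"
  shows "a = c \<or> below T a b"
  using assms(2)
proof (cases rule: rtranclp.cases)
  case (rtrancl_into_rtrancl y)
  then show ?thesis using child_unique[OF assms(1) _ assms(3)] by blast
qed simp

text \<open>The edges below a fixed edge form a chain because an edge has at most one
  parent.\<close>

lemma below_linear:
  assumes "is_tree T" "below T a c" "below T b c"
  shows "below T a b \<or> below T b a"
  using assms(2,3)
proof (induction arbitrary: b rule: rtranclp_induct)
  case (step y z)
  then show ?case
    using below_childD[OF assms(1) step.prems step.hyps(2)]
    by (metis rtranclp.rtrancl_into_rtrancl)
qed blast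

lemma root_below:
  fixes T :: "('e, 'v) rooted_graph"
  assumes "is_tree T" "e \<in> edges T"
  shows "below T (root_edge T) e"
proof -
  obtain h :: "'e \<Rightarrow> nat" where h: "\<And>a b. child T a b \<Longrightarrow> h a < h b"
    using tree_height assms by blast
  show ?thesis using assms(2)
  proof (induction "h e" arbitrary: e rule: less_induct)
    case less
    show ?case
    proof (cases "lower T e")
      case None
      then show ?thesis using assms less.prems by (auto simp: tree_lower_None)
    next
      case (Some v)
      have "child T (outgoing T v) e"
        using outgoing[of T v] tree_lower_vert[OF assms(1) less.prems Some] assms Some less.prems
        by (auto simp: child_def)
      then show ?thesis using less.hyps h
        by (metis child_def rtranclp.rtrancl_into_rtrancl)
    qed
  qed
qed

lemma leaf_below:
  assumes "x \<in> leaves T" "below T x y"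
  shows "y = x"
  using assms(2) by (cases rule: converse_rtranclpE) (use assms(1) in \<open>auto simp: leaves_def child_def\<close>)

text \<open>Climb from the root towards \<open>e\<close> while staying below \<open>e'\<close>. The
  vertex at which the path first leaves the edges below \<open>e'\<close> has one incoming edge
  towards \<open>e\<close> and a different one towards \<open>e'\<close>.\<close>

lemma incomparable_branch:
  assumes T: "is_tree T" and e: "e \<in> edges T" "e' \<in> edges T" "\<not> below T e e'" "\<not> below T e' e"
  obtains v a b where "v \<in> verts T" "a \<in> incoming T v" "b \<in> incoming T v" "a \<noteq> b"
    "below T a e" "below T b e'"
proof -
  have "\<exists>v\<in>verts T. \<exists>a\<in>incoming T v. \<exists>b\<in>incoming T v. a \<noteq> b \<and> below T a e \<and> below T b e'"
    if "below T r e" "below T r e'" for r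
    using that
  proof (induction rule: converse_rtranclp_induct)
    case base
    then show ?case using e by blast
  next
    case (step r a)
    show ?case
    proof (cases "below T a e'")
      case True
      then show ?thesis using step by blast
    next
      case False
      \<comment> \<open>Otherwise \<open>e'\<close> would lie below \<open>e\<close>. Hence the path
        from \<open>r\<close> to \<open>e'\<close> has a first step \<open>b\<close>, and
        \<open>b\<close> differs from \<open>a\<close> because \<open>a\<close> is not below
        \<open>e'\<close>.\<close>
      have "r \<noteq> e'" using step e by (meson converse_rtranclp_into_rtranclp)
      then obtain b where b: "child T r b" "below T b e'"
        using step.prems by (metis converse_rtranclpE)
      obtain v where v: "upper T r = Some v" "r \<in> edges T" using b by (auto simp: child_def)
      have "a \<in> incoming T v" "b \<in> incoming T v" "v \<in> verts T"
        using child_incoming[OF T v(2,1)] step b v T tree_upper_vert by auto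
      then show ?thesis using b step False by metis
    qed
  qed
  from this[of "root_edge T"] root_below[OF T] e that show thesis by blast
qed

section \<open>Subtrees and morphisms as covers\<close>

text \<open>The set \<open>L\<close> may be empty when no leaf of \<open>T\<close> lies above
  \<open>r\<close>; it then describes a subtree all of whose branches end in stumps.\<close>

definition cover :: "('e, 'v) rooted_graph \<Rightarrow> 'e \<Rightarrow> 'e set \<Rightarrow> bool" where
  "cover T r L \<longleftrightarrow> r \<in> edges T \<and> (\<forall>l \<in> L. below T r l) \<and>
     (\<forall>l \<in> L. \<forall>l' \<in> L. below T l l' \<longrightarrow> l = l') \<and>
     (\<forall>x \<in> leaves T. below T r x \<longrightarrow> (\<exists>l \<in> L. below T l x))"

lemma cover_edges: "cover T r L \<Longrightarrow> L \<subseteq> edges T"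
  using below_edges unfolding cover_def by fast

text \<open>A subtree is convex in the ambient order, so its leaves stay incomparable. A path from
  its root to a leaf of \<open>S\<close> can leave the subtree only through one of the subtree's own
  leaves.\<close>

lemma subtree_cover:
  assumes S: "is_tree S" and sub: "is_subtree S' S"
  shows "cover S (root_edge S') (leaves S')"
proof -
  have S': "is_tree S'" and es: "edges S' \<subseteq> edges S"
    and inc: "\<And>e v. e \<in> edges S' \<Longrightarrow> v \<in> verts S' \<Longrightarrow> upper S' e = Some v \<longleftrightarrow> upper S e = Some v"
    "\<And>e v. e \<in> edges S' \<Longrightarrow> v \<in> verts S' \<Longrightarrow> lower S' e = Some v \<longleftrightarrow> lower S e = Some v"
    "\<And>v. v \<in> verts S' \<Longrightarrow> incoming S v \<subseteq> edges S'"
    using sub unfolding is_subtree_def by blast+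
  let ?r = "root_edge S'"
  have child: "child S a b" if "child S' a b" for a b
    using that es inc S' tree_upper_vert unfolding child_def by (metis subsetD)
  have up: "below S a b" if "below S' a b" for a b
    using that by induction (auto intro: child rtranclp.rtrancl_into_rtrancl)
  \<comment> \<open>Convexity: whatever lies in \<open>S\<close> between the root of
    \<open>S'\<close> and an edge reached inside \<open>S'\<close> is itself reached inside
    \<open>S'\<close>, with the same order relation.\<close>
  have between: "below S' a b" if "below S' ?r b" "below S ?r a" "below S a b" for a b
    using that
  proof (induction arbitrary: a rule: rtranclp_induct)
    case base
    then show ?case using below_antisym[OF S] by blast
  next
    case (step b c)
    from below_childD[OF S step.prems(2) child[OF step.hyps(2)]] step
    show ?case by (metis rtranclp.rtrancl_into_rtrancl rtranclp.rtrancl_refl)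
  qed
  \<comment> \<open>Follow the path upwards to \<open>x\<close>: at each edge of \<open>S'\<close>
    either \<open>S'\<close> stops and a leaf has been found, or the vertex belongs to
    \<open>S'\<close> together with all its incoming edges and the path stays in
    \<open>S'\<close>.\<close>
  have leaf: "\<exists>l \<in> leaves S'. below S l x" if "below S a x" "a \<in> edges S'" "x \<in> leaves S" for a x
    using that
  proof (induction rule: converse_rtranclp_induct)
    case base
    have "upper S' x \<noteq> Some v" for v
      using base inc(1)[of x v] tree_upper_vert[OF S', of x v] by (auto simp: leaves_def)
    then have "x \<in> leaves S'" using base by (cases "upper S' x") (auto simp: leaves_def)
    then show ?case by blast
  next
    case (step a b)
    show ?case
    proof (cases "upper S' a")
      case None
      then have "a \<in> leaves S'" using step by (simp add: leaves_def)
      then show ?thesis using step by (meson converse_rtranclp_into_rtranclp)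
    next
      case (Some v)
      then have v: "v \<in> verts S'" using S' step tree_upper_vert by metis
      then have "b \<in> incoming S v" using step Some inc by (auto simp: child_def incoming_def)
      then show ?thesis using step v inc by blast
    qed
  qed
  have r: "below S ?r l" if "l \<in> leaves S'" for l
    using that up root_below[OF S'] by (auto simp: leaves_def)
  show ?thesis
    unfolding cover_def
  proof (intro conjI ballI impI)
    show "?r \<in> edges S" using es tree_root S' by auto
    show "below S ?r l" if "l \<in> leaves S'" for l using r that .
    show "l = l'" if "l \<in> leaves S'" "l' \<in> leaves S'" "below S l l'" for l l'
      using between[of l' l] that r root_below[OF S'] leaf_below[of l S' l']
      by (auto simp: leaves_def)
    show "\<exists>l\<in>leaves S'. below S l x" if "x \<in> leaves S" "below S ?r x" for x
      using leaf that tree_root S' by metis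
  qed
qed

text \<open>Cut \<open>S\<close> at \<open>r\<close> and at the elements of \<open>L\<close>: keep
  the edges above \<open>r\<close> that are not strictly above an element of \<open>L\<close>. The
  depth function of \<open>S\<close> still works for the part between the cuts.\<close>

lemma cover_subtree:
  fixes S :: "('e, 'v) rooted_graph"
  assumes S: "is_tree S" and c: "cover S r L"
  obtains S' where "is_subtree S' S" "root_edge S' = r" "leaves S' = L"
proof -
  let ?E = "{e \<in> edges S. below S r e \<and> (\<forall>l \<in> L. below S l e \<longrightarrow> l = e)}"
  let ?V = "{v \<in> verts S. \<exists>a \<in> edges S. upper S a = Some v \<and> below S r a \<and> (\<forall>l \<in> L. \<not> below S l a)}"
  \<comment> \<open>A vertex is kept if its outgoing edge is above \<open>r\<close> and above no
    element of \<open>L\<close>. The upper ends at \<open>L\<close> and the lower end at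
    \<open>r\<close> become loose.\<close>
  define S' where "S' = \<lparr>edges = ?E, verts = ?V,
    upper = (\<lambda>e. if e \<in> L then None else upper S e),
    lower = (\<lambda>e. if e = r then None else lower S e), root_edge = r\<rparr>"
  have r: "r \<in> edges S" and rL: "\<And>l. l \<in> L \<Longrightarrow> below S r l"
    and anti: "\<And>l l'. l \<in> L \<Longrightarrow> l' \<in> L \<Longrightarrow> below S l l' \<Longrightarrow> l = l'"
    and lf: "\<And>x. x \<in> leaves S \<Longrightarrow> below S r x \<Longrightarrow> \<exists>l \<in> L. below S l x"
    using c by (auto simp: cover_def)
  have LE: "L \<subseteq> ?E" using cover_edges[OF c] rL anti by auto
  obtain d :: "'v \<Rightarrow> nat" where d:
    "\<And>e v w. e \<in> edges S \<Longrightarrow> upper S e = Some v \<Longrightarrow> lower S e = Some w \<Longrightarrow> d w < d v"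
    using tree_depth S by blast
  have out: "child S (outgoing S v) e" if "e \<in> edges S" "lower S e = Some v" for e v
    using outgoing[of S v] tree_lower_vert[OF S that] S that by (auto simp: child_def)
  have tree: "is_tree S'"
  proof (rule is_treeI[of _ d])
    show "finite (edges S')" "finite (verts S')" using S by (auto simp: S'_def is_tree_def)
    show "root_edge S' \<in> edges S'" using r rL below_antisym[OF S] by (auto simp: S'_def)
    show "v \<in> verts S'" if "e \<in> edges S'" "upper S' e = Some v" for e v
      using that tree_upper_vert[OF S] by (auto simp: S'_def split: if_splits)
    show "v \<in> verts S'" if "e \<in> edges S'" "lower S' e = Some v" for e v
    proof -
      from that have e: "e \<in> edges S" "e \<noteq> r" "below S r e" "\<And>l. l \<in> L \<Longrightarrow> below S l e \<Longrightarrow> l = e"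
        and v: "lower S e = Some v" by (auto simp: S'_def split: if_splits)
      note ch = out[OF e(1) v]
      have "below S r (outgoing S v)" using below_childD[OF S e(3) ch] e by auto
      moreover have "\<not> below S l (outgoing S v)" if "l \<in> L" for l
        using e(4)[OF that] child_below_antisym[OF S ch] ch
        by (metis rtranclp.rtrancl_into_rtrancl)
      moreover have "v \<in> verts S" using S e v tree_lower_vert by metis
      ultimately show ?thesis using outgoing[OF S, of v] by (auto simp: S'_def)
    qed
    \<comment> \<open>An edge of \<open>S'\<close> with loose lower end in \<open>S\<close> is the
      root of \<open>S\<close>, hence both below and above \<open>r\<close>, hence equal to
      \<open>r\<close>.\<close>
    show "lower S' e = None \<longleftrightarrow> e = root_edge S'" if "e \<in> edges S'" for e
      using that tree_lower_None[OF S, of e] root_below[OF S r] below_antisym[OF S]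
      by (auto simp: S'_def)
    show "\<exists>!e. e \<in> edges S' \<and> upper S' e = Some v" if "v \<in> verts S'" for v
    proof -
      from that obtain a where a: "a \<in> edges S" "upper S a = Some v" "below S r a"
        "\<forall>l \<in> L. \<not> below S l a" by (auto simp: S'_def)
      then have "a \<notin> L" by auto
      show ?thesis
      proof (rule ex1I[of _ a])
        show "a \<in> edges S' \<and> upper S' a = Some v" using a \<open>a \<notin> L\<close> by (auto simp: S'_def)
        show "e = a" if "e \<in> edges S' \<and> upper S' e = Some v" for e
          using that tree_upper_unique[OF S _ a(1) _ a(2), of e]
          by (simp add: S'_def split: if_splits)
      qed
    qed
    show "d w < d v" if "e \<in> edges S'" "upper S' e = Some v" "lower S' e = Some w" for e v w
      using that d by (auto simp: S'_def split: if_splits)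
  qed
  have "is_subtree S' S"
    unfolding is_subtree_def
  proof (intro conjI ballI)
    show "is_tree S'" by (rule tree)
    show "edges S' \<subseteq> edges S" "verts S' \<subseteq> verts S" by (auto simp: S'_def)
  next
    fix e v assume e: "e \<in> edges S'" and "v \<in> verts S'"
    then obtain a where a: "a \<in> edges S" "upper S a = Some v" "below S r a"
        "\<forall>l \<in> L. \<not> below S l a" by (auto simp: S'_def)
    \<comment> \<open>No incidence with a kept vertex is lost by the cuts: the outgoing edge
      \<open>a\<close> of \<open>v\<close> is above no element of \<open>L\<close>, and below,
      \<open>r\<close> cannot enter \<open>v\<close> because \<open>a\<close> would then be strictly
      below \<open>r\<close>.\<close>
    have "upper S e \<noteq> Some v" if "e \<in> L"
      using tree_upper_unique[OF S a(1) _ a(2), of e] e a(4) that by (auto simp: S'_def)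
    then show "upper S' e = Some v \<longleftrightarrow> upper S e = Some v" by (auto simp: S'_def)
    have "lower S r \<noteq> Some v"
    proof
      assume "lower S r = Some v"
      then have "child S a r" using a r by (auto simp: child_def)
      then show False using child_below_antisym[OF S _ a(3)] by auto
    qed
    then show "lower S' e = Some v \<longleftrightarrow> lower S e = Some v" by (auto simp: S'_def)
  next
    fix v assume "v \<in> verts S'"
    then obtain a where a: "a \<in> edges S" "upper S a = Some v" "below S r a"
        "\<forall>l \<in> L. \<not> below S l a" by (auto simp: S'_def)
    show "incoming S v \<subseteq> edges S'"
    proof
      fix b assume "b \<in> incoming S v"
      then have ch: "child S a b" using child_incoming[OF S a(1,2)] by auto
      then have "below S r b" using a by (metis rtranclp.rtrancl_into_rtrancl)
      moreover have "l = b" if "l \<in> L" "below S l b" for l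
        using below_childD[OF S that(2) ch] that a by auto
      ultimately show "b \<in> edges S'" using ch by (auto simp: S'_def child_def)
    qed
  qed
  moreover have "leaves S' = L"
  proof
    show "leaves S' \<subseteq> L"
    proof
      fix x assume "x \<in> leaves S'"
      then have x: "x \<in> ?E" "x \<in> L \<or> upper S x = None" by (auto simp: S'_def leaves_def split: if_splits)
      then show "x \<in> L" using lf[of x] by (auto simp: leaves_def)
    qed
    show "L \<subseteq> leaves S'" using LE by (auto simp: S'_def leaves_def)
  qed
  ultimately show thesis using that by (auto simp: S'_def)
qed

section \<open>Morphisms of trees in terms of covers\<close>

lemma dend_hom_edge: "f \<in> dend_hom T S \<Longrightarrow> e \<in> edges T \<Longrightarrow> f e \<in> edges S"
  and dend_hom_undefined: "f \<in> dend_hom T S \<Longrightarrow> e \<notin> edges T \<Longrightarrow> f e = undefined"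
  by (auto simp: dend_hom_def)

text \<open>Trades the existence of a subtree for the order condition \<open>cover\<close>; from
  here on subtrees no longer appear.\<close>

lemma dend_hom_iff:
  assumes "is_tree S"
  shows "f \<in> dend_hom T S \<longleftrightarrow> f \<in> edges T \<rightarrow>\<^sub>E edges S \<and>
    (\<forall>v \<in> verts T. inj_on f (incoming T v) \<and> cover S (f (outgoing T v)) (f ` incoming T v))"
proof -
  have "(\<exists>S'. is_subtree S' S \<and> root_edge S' = r \<and> P \<and> leaves S' = L) \<longleftrightarrow> P \<and> cover S r L" for r L P
    by (metis assms subtree_cover cover_subtree)
  then show ?thesis unfolding dend_hom_def by auto
qed

lemma cover_corolla:
  assumes T: "is_tree T" "v \<in> verts T"
  shows "cover T (outgoing T v) (incoming T v)"
proof -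
  let ?a = "outgoing T v"
  note a = outgoing[OF T]
  note ch = child_incoming[OF T(1) a]
  show ?thesis
    unfolding cover_def
  proof (intro conjI ballI impI)
    show "?a \<in> edges T" by (rule a)
    show "below T ?a l" if "l \<in> incoming T v" for l using that ch by blast
    show "l = l'" if "l \<in> incoming T v" "l' \<in> incoming T v" "below T l l'" for l l'
      using that below_childD[OF T(1) that(3), of ?a] ch child_below_antisym[OF T(1)] by blast
    show "\<exists>l\<in>incoming T v. below T l x" if "x \<in> leaves T" "below T ?a x" for x
      using that(2)
    proof (cases rule: converse_rtranclpE)
      case base
      then show ?thesis using a that by (auto simp: leaves_def)
    qed (use ch in blast)
  qed
qed

lemma cover_refl: "r \<in> edges T \<Longrightarrow> cover T r {r}"
  by (auto simp: cover_def)

text \<open>The cover of the largest subtree with root \<open>r\<close>. The extension of a morphism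
  to a grafted tree sends the corolla over each leaf to such a cover.\<close>

lemma cover_leaves: "r \<in> edges T \<Longrightarrow> cover T r {x \<in> leaves T. below T r x}"
  unfolding cover_def using leaf_below by fast

text \<open>The counterpart of grafting subtrees onto the leaves of a subtree. If
  \<open>m \<in> M l\<close> is below \<open>m' \<in> M l'\<close>, then \<open>l\<close> and
  \<open>l'\<close> are both below \<open>m'\<close>, hence comparable, hence equal.\<close>

lemma cover_UN:
  assumes T: "is_tree T" and c: "cover T r L" and M: "\<And>l. l \<in> L \<Longrightarrow> cover T l (M l)"
  shows "cover T r (\<Union>l\<in>L. M l)"
  unfolding cover_def
proof (intro conjI ballI impI)
  show "r \<in> edges T" using c by (simp add: cover_def)
  show "below T r m" if "m \<in> (\<Union>l\<in>L. M l)" for m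
    using that c M unfolding cover_def by (meson UN_E rtranclp_trans)
  show "m = m'" if m: "m \<in> (\<Union>l\<in>L. M l)" "m' \<in> (\<Union>l\<in>L. M l)" "below T m m'" for m m'
  proof -
    obtain l l' where l: "l \<in> L" "m \<in> M l" "l' \<in> L" "m' \<in> M l'" using m by auto
    then have "below T l m'" "below T l' m'" using M m unfolding cover_def by (meson rtranclp_trans)+
    then have "l = l'" using below_linear[OF T] c l unfolding cover_def by metis
    then show ?thesis using M l m unfolding cover_def by metis
  qed
  show "\<exists>m\<in>\<Union>l\<in>L. M l. below T m x" if "x \<in> leaves T" "below T r x" for x
    using that c M unfolding cover_def by (metis UN_I)
qed

lemma dend_hom_below:
  assumes T: "is_tree T" and S: "is_tree S" and f: "f \<in> dend_hom T S" and "below T a b"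
  shows "below S (f a) (f b)"
  using assms(4)
proof induction
  case (step y z)
  then obtain v where v: "upper T y = Some v" "lower T z = Some v" "y \<in> edges T" "z \<in> edges T"
    by (auto simp: child_def)
  have "cover S (f y) (f ` incoming T v)"
    using f tree_upper_vert[OF T] outgoing_eq[OF T] v unfolding dend_hom_iff[OF S] by metis
  moreover have "z \<in> incoming T v" using v by (simp add: incoming_def)
  ultimately have "below S (f y) (f z)" by (auto simp: cover_def)
  with step show ?case by (meson rtranclp_trans)
qed simp

text \<open>Incomparable edges lie over different inputs \<open>a\<close> and \<open>b\<close> of
  some vertex. If their images were comparable, \<open>f a\<close> and \<open>f b\<close> would lie
  below a common edge and so be comparable members of a cover; they would coincide, against
  injectivity on inputs.\<close>

lemma dend_hom_comparable:
  assumes T: "is_tree T" and S: "is_tree S" and f: "f \<in> dend_hom T S"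
    and e: "e \<in> edges T" "e' \<in> edges T" and le: "below S (f e) (f e')"
  shows "below T e e' \<or> below T e' e"
proof (rule ccontr)
  assume "\<not> ?thesis"
  then obtain v a b where v: "v \<in> verts T" "a \<in> incoming T v" "b \<in> incoming T v" "a \<noteq> b"
    "below T a e" "below T b e'"
    using incomparable_branch[OF T e] by metis
  have "below S (f a) (f e')" "below S (f b) (f e')"
    using v dend_hom_below[OF T S f] le by (meson rtranclp_trans)+
  then have "below S (f a) (f b) \<or> below S (f b) (f a)" using below_linear[OF S] by blast
  moreover have "inj_on f (incoming T v)" "cover S (f (outgoing T v)) (f ` incoming T v)"
    using f v dend_hom_iff[OF S] by auto
  ultimately have "f a = f b" using v unfolding cover_def by (metis imageI)
  with \<open>inj_on f _\<close> v show False by (auto dest: inj_onD)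
qed

text \<open>Extends the defining property of a morphism from corollas to arbitrary covers, which is
  what makes composition work. Injectivity and the antichain condition hold because morphisms
  reflect comparability.\<close>

lemma dend_hom_cover:
  fixes T :: "('e, 'v) rooted_graph"
  assumes T: "is_tree T" and S: "is_tree S" and f: "f \<in> dend_hom T S" and c: "cover T r L"
  shows "inj_on f L" "cover S (f r) (f ` L)"
proof -
  note LE = cover_edges[OF c]
  have anti: "l = l'" if "l \<in> L" "l' \<in> L" "below S (f l) (f l')" for l l'
    using dend_hom_comparable[OF T S f] c LE that unfolding cover_def by blast
  then show "inj_on f L" by (metis inj_onI rtranclp.rtrancl_refl)
  have leaf: "\<exists>l \<in> L. below S (f l) x" if x: "x \<in> leaves S" "below S (f e) x" and e: "below T r e" for x e
  proof -
    have r: "r \<in> edges T" using c by (simp add: cover_def)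
    obtain h :: "'e \<Rightarrow> nat" where h: "\<And>a b. child T a b \<Longrightarrow> h a < h b"
      using tree_height T by blast
    let ?A = "{e. below T r e \<and> below S (f e) x}"
    have "?A \<subseteq> edges T" using below_edges[of T r] r by blast
    have "finite (edges T)" using T by (simp add: is_tree_def)
    then have "finite ?A" using \<open>?A \<subseteq> edges T\<close> finite_subset by blast
    \<comment> \<open>Take a highest edge \<open>m\<close> above \<open>r\<close> whose image is
      still below \<open>x\<close>. If \<open>m\<close> is a leaf, the cover \<open>L\<close> has an
      element below it. Otherwise the cover of \<open>f m\<close> provides an input of the vertex
      over \<open>m\<close> that also qualifies and is higher.\<close>
    then obtain m where m: "m \<in> ?A" "\<And>e. e \<in> ?A \<Longrightarrow> h e \<le> h m"
      using x e finite_has_max_measure[of ?A h] by blast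
    have mE: "m \<in> edges T" using m \<open>?A \<subseteq> edges T\<close> by blast
    show ?thesis
    proof (cases "upper T m")
      case None
      then have "m \<in> leaves T" using mE by (simp add: leaves_def)
      then obtain l where "l \<in> L" "below T l m" using c m by (auto simp: cover_def)
      then show ?thesis using m dend_hom_below[OF T S f] by (metis mem_Collect_eq rtranclp_trans)
    next
      case (Some v)
      then have "cover S (f m) (f ` incoming T v)"
        using f tree_upper_vert[OF T] outgoing_eq[OF T] mE unfolding dend_hom_iff[OF S] by metis
      then obtain b where b: "b \<in> incoming T v" "below S (f b) x"
        using x m by (auto simp: cover_def)
      then have "child T m b" using child_incoming[OF T mE Some] by simp
      then have "b \<in> ?A" "h m < h b" using b m h by (auto intro: rtranclp.rtrancl_into_rtrancl)
      then show ?thesis using m by fastforce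
    qed
  qed
  show "cover S (f r) (f ` L)"
    unfolding cover_def
  proof (intro conjI ballI impI)
    show "f r \<in> edges S" using f c by (auto simp: dend_hom_def cover_def)
    show "below S (f r) l" if "l \<in> f ` L" for l
      using that c dend_hom_below[OF T S f] by (auto simp: cover_def)
    show "l = l'" if "l \<in> f ` L" "l' \<in> f ` L" "below S l l'" for l l' using that anti by auto
    show "\<exists>l\<in>f ` L. below S l x" if "x \<in> leaves S" "below S (f r) x" for x
      using leaf[OF that] by blast
  qed
qed

lemma dend_hom_id: "is_tree T \<Longrightarrow> restrict (\<lambda>e. e) (edges T) \<in> dend_hom T T"
  unfolding dend_hom_iff
proof (intro conjI ballI)
  fix v assume T: "is_tree T" "v \<in> verts T"
  have inc: "incoming T v \<subseteq> edges T" by (auto simp: incoming_def)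
  show "inj_on (restrict (\<lambda>e. e) (edges T)) (incoming T v)"
    by (intro inj_onI) (metis restrict_apply' subsetD[OF inc])
  have "restrict (\<lambda>e. e) (edges T) ` incoming T v = incoming T v" using inc by force
  then show "cover T (restrict (\<lambda>e. e) (edges T) (outgoing T v)) (restrict (\<lambda>e. e) (edges T) ` incoming T v)"
    using cover_corolla[OF T] outgoing[OF T] by simp
qed simp

text \<open>The first map sends a corolla to a cover, and the second sends covers to covers.\<close>

lemma dend_hom_compose:
  assumes T: "is_tree T" and S: "is_tree S" and R: "is_tree R"
    and f: "f \<in> dend_hom T S" and g: "g \<in> dend_hom S R"
  shows "compose (edges T) g f \<in> dend_hom T R"
  unfolding dend_hom_iff[OF R]
proof (intro conjI ballI)
  show "compose (edges T) g f \<in> edges T \<rightarrow>\<^sub>E edges R"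
    using f g by (auto simp: dend_hom_def compose_def)
next
  fix v assume v: "v \<in> verts T"
  have inc: "incoming T v \<subseteq> edges T" by (auto simp: incoming_def)
  have inj: "inj_on f (incoming T v)" and c: "cover S (f (outgoing T v)) (f ` incoming T v)"
    using f v dend_hom_iff[OF S] by auto
  note gc = dend_hom_cover[OF S R g c]
  have eq: "compose (edges T) g f e = g (f e)" if "e \<in> edges T" for e
    using that by (simp add: compose_def)
  have "inj_on (\<lambda>e. g (f e)) (incoming T v)" using comp_inj_on[OF inj gc(1)] by (simp add: comp_def)
  then show "inj_on (compose (edges T) g f) (incoming T v)"
    using inc eq by (subst inj_on_cong[of _ _ "\<lambda>e. g (f e)"]) auto
  have "compose (edges T) g f ` incoming T v = g ` f ` incoming T v" using inc eq by force
  then show "cover R (compose (edges T) g f (outgoing T v)) (compose (edges T) g f ` incoming T v)"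
    using gc(2) outgoing[OF T v] eq by simp
qed

lemma Omega_category: "is_category Omega"
  unfolding is_category_def
  by (auto simp: Omega_def dend_hom_id dend_hom_edge dend_hom_undefined fun_eq_iff compose_def
      intro: dend_hom_compose[unfolded compose_def])

section \<open>Grafting\<close>

text \<open>The definitions of grafting match on a pair. Restated with projections and one rule per
  kind of name, they simplify for a variable \<open>X\<close>.\<close>

lemma edges_graft: "edges (fst (graft m n \<phi> X)) = Old ` edges (fst X) \<union> New ` {1..m} \<union> {NewRoot}"
  and verts_graft: "verts (fst (graft m n \<phi> X)) = Old ` verts (fst X) \<union> New ` {1..n} \<union> {NewRoot}"
  and root_graft [simp]: "root_edge (fst (graft m n \<phi> X)) = NewRoot"
  and labels_graft [simp]: "snd (graft m n \<phi> X) = restrict New {1..m}"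
  by (auto simp: graft_def split: prod.split)

lemma edge_graft_iff [simp]:
  "Old e \<in> edges (fst (graft m n \<phi> X)) \<longleftrightarrow> e \<in> edges (fst X)"
  "New j \<in> edges (fst (graft m n \<phi> X)) \<longleftrightarrow> j \<in> {1..m}"
  "NewRoot \<in> edges (fst (graft m n \<phi> X))"
  "Atom a \<notin> edges (fst (graft m n \<phi> X))"
  by (auto simp: edges_graft)

lemma vert_graft_iff [simp]:
  "Old v \<in> verts (fst (graft m n \<phi> X)) \<longleftrightarrow> v \<in> verts (fst X)"
  "New i \<in> verts (fst (graft m n \<phi> X)) \<longleftrightarrow> i \<in> {1..n}"
  "NewRoot \<in> verts (fst (graft m n \<phi> X))"
  "Atom a \<notin> verts (fst (graft m n \<phi> X))"
  by (auto simp: verts_graft)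

lemma upper_graft [simp]:
  "upper (fst (graft m n \<phi> X)) (Old e) = (case upper (fst X) e of Some v \<Rightarrow> Some (Old v)
     | None \<Rightarrow> Some (New (inv_into {1..n} (snd X) e)))"
  "upper (fst (graft m n \<phi> X)) (New j) = None"
  "upper (fst (graft m n \<phi> X)) NewRoot = Some NewRoot"
  by (auto simp: graft_def graft_upper_def split: prod.split option.split)

lemma lower_graft [simp]:
  "lower (fst (graft m n \<phi> X)) (Old e) =
     (if e = root_edge (fst X) then Some NewRoot else map_option Old (lower (fst X) e))"
  "lower (fst (graft m n \<phi> X)) (New j) = (case \<phi> (Some j) of Some i \<Rightarrow> Some (New i) | None \<Rightarrow> Some NewRoot)"
  "lower (fst (graft m n \<phi> X)) NewRoot = None"
  by (auto simp: graft_def graft_lower_def split: prod.split option.split)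

lemma leaves_graft: "leaves (fst (graft m n \<phi> X)) = New ` {1..m}"
  by (auto simp: leaves_def edges_graft split: option.splits)

lemma graft_map_simps [simp]:
  "graft_map m n \<phi> X f (Old e) = (if e \<in> edges (fst X) then Old (f e) else undefined)"
  "graft_map m n \<phi> X f (New j) = (if j \<in> {1..m} then New j else undefined)"
  "graft_map m n \<phi> X f NewRoot = NewRoot"
  "graft_map m n \<phi> X f (Atom a) = undefined"
  by (simp_all add: graft_map_def)

lemma tau_unit_simps [simp]:
  "tau_unit n X (Old e) = (if e \<in> edges (fst X) then e else undefined)"
  "tau_unit n X (New j) = (if j \<in> {1..n} then snd X j else undefined)"
  "tau_unit n X NewRoot = root_edge (fst X)"
  "tau_unit n X (Atom a) = undefined"
  by (simp_all add: tau_unit_def split: prod.split)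

lemma tau_comp_simps [simp]:
  "tau_comp l m n \<gamma> \<phi> X (Old e) = (if e \<in> edges (fst X) then Old (Old e) else undefined)"
  "tau_comp l m n \<gamma> \<phi> X (New j) = (if j \<in> {1..l} then New j else undefined)"
  "tau_comp l m n \<gamma> \<phi> X NewRoot = NewRoot"
  "tau_comp l m n \<gamma> \<phi> X (Atom a) = undefined"
  by (simp_all add: tau_comp_def)

lemma name_fun_eqI:
  assumes "\<And>e. f (Old e) = g (Old e)" "\<And>j. f (New j) = g (New j)" "f NewRoot = g NewRoot"
    "\<And>a. f (Atom a) = g (Atom a)"
  shows "f = g"
proof
  show "f x = g x" for x using assms by (cases x) auto
qed

lemma Fin_pt_value:
  assumes "\<phi> \<in> Hom Fin_pt m n" "j \<in> {1..m}"
  shows "\<phi> (Some j) = None \<or> (\<exists>i \<in> {1..n}. \<phi> (Some j) = Some i)"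
proof -
  have "\<phi> (Some j) \<in> pset n" using assms by (auto simp: Fin_pt_def pset_def)
  then show ?thesis by (auto simp: pset_def)
qed

lemma Fin_pt_category: "is_category Fin_pt"
proof -
  have "None \<in> pset n" for n by (simp add: pset_def)
  then show ?thesis
    unfolding is_category_def
    by (auto simp: Fin_pt_def compose_def fun_eq_iff dest: PiE_mem PiE_arb)
qed

section \<open>The categories of labeled trees\<close>

lemma obj_labeled: "X \<in> Obj (labeled_trees n) \<longleftrightarrow>
    is_tree (fst X) \<and> snd X \<in> extensional {1..n} \<and> bij_betw (snd X) {1..n} (leaves (fst X))"
  by (auto simp: labeled_trees_def)

lemma hom_labeled: "f \<in> Hom (labeled_trees n) X Y \<longleftrightarrow> f \<in> dend_hom (fst X) (fst Y) \<and>
    f ` leaves (fst X) \<subseteq> leaves (fst Y) \<and> f (root_edge (fst X)) = root_edge (fst Y) \<and>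
    (\<forall>i \<in> {1..n}. f (snd X i) = snd Y i)"
  by (auto simp: labeled_trees_def labeled_hom_def split: prod.splits)

lemma idn_labeled: "Idn (labeled_trees n) X = restrict (\<lambda>e. e) (edges (fst X))"
  by (auto simp: labeled_trees_def split: prod.splits)

lemma cmp_labeled: "Cmp (labeled_trees n) X Y Z g f = compose (edges (fst X)) g f"
  by (auto simp: labeled_trees_def split: prod.splits)

lemma label_edge:
  assumes "X \<in> Obj (labeled_trees n)" "i \<in> {1..n}"
  shows "snd X i \<in> leaves (fst X)" "snd X i \<in> edges (fst X)"
proof -
  show "snd X i \<in> leaves (fst X)" using assms unfolding obj_labeled bij_betw_def by blast
  then show "snd X i \<in> edges (fst X)" by (simp add: leaves_def)
qed

lemma labeled_category: "is_category (labeled_trees n)"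
  unfolding is_category_def
proof (intro conjI ballI)
  fix X :: "('a, 'b) labeled_graph" assume X: "X \<in> Obj (labeled_trees n)"
  then have T: "is_tree (fst X)" by (simp add: obj_labeled)
  show "Idn (labeled_trees n) X \<in> Hom (labeled_trees n) X X"
    using label_edge[OF X] by (auto simp: idn_labeled hom_labeled dend_hom_id[OF T] tree_root[OF T] leaves_def)
next
  fix X Y Z :: "('a, 'b) labeled_graph" and f g
  assume X: "X \<in> Obj (labeled_trees n)" "Y \<in> Obj (labeled_trees n)" "Z \<in> Obj (labeled_trees n)"
    and f: "f \<in> Hom (labeled_trees n) X Y" and g: "g \<in> Hom (labeled_trees n) Y Z"
  have "compose (edges (fst X)) g f \<in> dend_hom (fst X) (fst Z)"
    using X f g by (auto simp: obj_labeled hom_labeled intro!: dend_hom_compose[of _ "fst Y"])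
  moreover have "compose (edges (fst X)) g f e = g (f e)" if "e \<in> edges (fst X)" for e
    using that by (simp add: compose_def)
  moreover have "root_edge (fst X) \<in> edges (fst X)" using X by (simp add: obj_labeled tree_root)
  moreover have "e \<in> leaves (fst X) \<Longrightarrow> e \<in> edges (fst X)" for e by (simp add: leaves_def)
  ultimately show "Cmp (labeled_trees n) X Y Z g f \<in> Hom (labeled_trees n) X Z"
    using label_edge[OF X(1)] f g by (simp add: hom_labeled cmp_labeled image_subset_iff)
next
  fix X Y :: "('a, 'b) labeled_graph" and f
  assume "f \<in> Hom (labeled_trees n) X Y"
  then have f: "f \<in> dend_hom (fst X) (fst Y)" by (simp add: hom_labeled)
  show "Cmp (labeled_trees n) X X Y f (Idn (labeled_trees n) X) = f"
    "Cmp (labeled_trees n) X Y Y (Idn (labeled_trees n) Y) f = f"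
    using dend_hom_edge[OF f] dend_hom_undefined[OF f]
    by (auto simp: cmp_labeled idn_labeled compose_def fun_eq_iff)
next
  fix X Y Z W :: "('a, 'b) labeled_graph" and f g h
  assume f: "f \<in> Hom (labeled_trees n) X Y"
  then show "Cmp (labeled_trees n) X Z W h (Cmp (labeled_trees n) X Y Z g f) =
       Cmp (labeled_trees n) X Y W (Cmp (labeled_trees n) Y Z W h g) f"
    by (auto simp: hom_labeled cmp_labeled compose_def fun_eq_iff dend_hom_edge)
qed

section \<open>Grafted trees and morphisms out of them\<close>

locale grafting =
  fixes m n :: nat and \<phi> :: "nat option \<Rightarrow> nat option" and X :: "'a lgraph"
  assumes X: "X \<in> Obj (labeled_trees n)" and \<phi>: "\<phi> \<in> Hom Fin_pt m n"
begin

abbreviation T where "T \<equiv> fst X"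
abbreviation \<chi> where "\<chi> \<equiv> snd X"
abbreviation G where "G \<equiv> fst (graft m n \<phi> X)"

lemma tree: "is_tree T" and labels: "bij_betw \<chi> {1..n} (leaves T)"
  using X by (auto simp: obj_labeled)

lemma upper_label: "i \<in> {1..n} \<Longrightarrow> upper G (Old (\<chi> i)) = Some (New i)"
  using labels label_edge[OF X, of i] by (simp add: leaves_def bij_betw_def)

lemma leaf_label:
  assumes "e \<in> edges T" "upper T e = None"
  obtains i where "i \<in> {1..n}" "e = \<chi> i" "inv_into {1..n} \<chi> e = i"
proof -
  have "e \<in> \<chi> ` {1..n}" using labels assms by (simp add: bij_betw_def leaves_def)
  then obtain i where i: "i \<in> {1..n}" "e = \<chi> i" by blast
  moreover have "inv_into {1..n} \<chi> e = i"
    using bij_betw_inv_into_left[OF labels i(1)] i(2) by simp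
  ultimately show thesis by (rule that)
qed

lemma root_lower: "lower T (root_edge T) = None"
  using tree_lower_None[OF tree] tree_root[OF tree] by blast

lemma tree_graft: "is_tree G"
proof -
  obtain d :: "'a name \<Rightarrow> nat" where d:
    "\<And>e v w. e \<in> edges T \<Longrightarrow> upper T e = Some v \<Longrightarrow> lower T e = Some w \<Longrightarrow> d w < d v"
    using tree_depth tree by blast
  have "finite (d ` verts T)" using tree by (simp add: is_tree_def)
  then obtain K where K: "\<And>v. v \<in> verts T \<Longrightarrow> d v < K"
    unfolding finite_nat_set_iff_bounded by blast
  show ?thesis
  \<comment> \<open>The bottom vertex gets depth 0, old depths are shifted by one, and the new top
    vertices lie beyond every old vertex because \<open>K\<close> bounds the old depths
    strictly.\<close>
  proof (rule is_treeI[of _ "\<lambda>x. case x of Old v \<Rightarrow> Suc (d v) | New i \<Rightarrow> Suc K | NewRoot \<Rightarrow> 0 | Atom a \<Rightarrow> 0"])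
    show "finite (edges G)" "finite (verts G)"
      using tree by (auto simp: is_tree_def edges_graft verts_graft)
    show "root_edge G \<in> edges G" by simp
  next
    fix e assume e: "e \<in> edges G"
    show "lower G e = None \<longleftrightarrow> e = root_edge G"
      using e tree_lower_None[OF tree] by (cases e) (auto split: option.split)
    show "v \<in> verts G" if "upper G e = Some v" for v
      using e that tree_upper_vert[OF tree]
      by (cases e) (auto split: option.splits elim: leaf_label)
    show v: "v \<in> verts G" if "lower G e = Some v" for v
      using e that tree_lower_vert[OF tree] Fin_pt_value[OF \<phi>]
      by (cases e) (force split: option.splits if_splits)+
    show "(case w of Old v \<Rightarrow> Suc (d v) | New i \<Rightarrow> Suc K | NewRoot \<Rightarrow> 0 | Atom a \<Rightarrow> 0)
        < (case v of Old v \<Rightarrow> Suc (d v) | New i \<Rightarrow> Suc K | NewRoot \<Rightarrow> 0 | Atom a \<Rightarrow> 0)"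
      if "upper G e = Some v" "lower G e = Some w" for v w
      using e that K tree_lower_vert[OF tree] d
      by (cases e) (auto split: option.splits if_splits)
  next
    fix v assume v: "v \<in> verts G"
    have up: "\<exists>e. e \<in> edges G \<and> upper G e = Some v"
    proof (cases v)
      case (Old w)
      then show ?thesis using outgoing[OF tree, of w] v by (intro exI[of _ "Old (outgoing T w)"]) auto
    next
      case (New i)
      then show ?thesis using upper_label[of i] label_edge[OF X, of i] v
        by (intro exI[of _ "Old (\<chi> i)"]) auto
    next
      case NewRoot
      then show ?thesis by (intro exI[of _ NewRoot]) auto
    qed (use v in auto)
    \<comment> \<open>The only candidate for the outgoing edge of \<open>v\<close>. In the bottom
      case it is \<open>v\<close> itself, as the new root edge and the bottom vertex share the name
      \<open>NewRoot\<close>.\<close>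
    let ?e = "case v of Old w \<Rightarrow> Old (outgoing T w) | New i \<Rightarrow> Old (\<chi> i) | _ \<Rightarrow> v"
    have uniq: "e = ?e" if e: "e \<in> edges G" "upper G e = Some v" for e
    proof (cases e)
      case (Old a)
      then have a: "a \<in> edges T" using e by simp
      show ?thesis
      proof (cases "upper T a")
        case None
        obtain i where "a = \<chi> i" "inv_into {1..n} \<chi> a = i" using leaf_label[OF a None] .
        then show ?thesis using e Old None by auto
      next
        case (Some w)
        then show ?thesis using e Old outgoing_eq[OF tree a Some] by auto
      qed
    qed (use e in auto)
    show "\<exists>!e. e \<in> edges G \<and> upper G e = Some v" using up uniq by blast
  qed
qed

lemma outgoing_graft:
  "v \<in> verts T \<Longrightarrow> outgoing G (Old v) = Old (outgoing T v)"
  "i \<in> {1..n} \<Longrightarrow> outgoing G (New i) = Old (\<chi> i)"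
  "outgoing G NewRoot = NewRoot"
  using outgoing[OF tree] upper_label label_edge[OF X]
  by (auto intro!: outgoing_eq[OF tree_graft])

lemma incoming_graft:
  "incoming G (Old v) = Old ` incoming T v"
  "incoming G (New i) = New ` {j \<in> {1..m}. \<phi> (Some j) = Some i}"
  "incoming G NewRoot = insert (Old (root_edge T)) (New ` {j \<in> {1..m}. \<phi> (Some j) = None})"
  using root_lower tree_root[OF tree]
  by (auto simp: incoming_def edges_graft split: option.splits if_splits)

lemma graft_labels: "bij_betw (restrict New {1..m}) {1..m} (leaves G)"
  by (auto simp: bij_betw_def leaves_graft inj_on_def)

lemma graft_obj: "graft m n \<phi> X \<in> Obj (labeled_trees m)"
  using tree_graft graft_labels by (auto simp: obj_labeled)

lemma cover_new: "i \<in> {1..n} \<Longrightarrow> cover G (Old (\<chi> i)) (New ` {j \<in> {1..m}. \<phi> (Some j) = Some i})"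
  using cover_corolla[OF tree_graft, of "New i"] by (simp add: outgoing_graft incoming_graft)

lemma cover_new_root:
  "cover G NewRoot (insert (Old (root_edge T)) (New ` {j \<in> {1..m}. \<phi> (Some j) = None}))"
  using cover_corolla[OF tree_graft, of NewRoot] by (simp add: outgoing_graft incoming_graft)

lemma graft_inclusion: "(\<lambda>e \<in> edges T. Old e) \<in> dend_hom T G"
  unfolding dend_hom_iff[OF tree_graft]
proof (intro conjI ballI)
  fix v assume v: "v \<in> verts T"
  have eq: "(\<lambda>e \<in> edges T. Old e) e = Old e" if "e \<in> incoming T v" for e
    using that by (auto simp: incoming_def)
  show "inj_on (\<lambda>e \<in> edges T. Old e) (incoming T v)" by (auto simp: inj_on_def incoming_def)
  have "(\<lambda>e \<in> edges T. Old e) ` incoming T v = Old ` incoming T v" by (rule image_cong[OF refl eq])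
  then show "cover G ((\<lambda>e \<in> edges T. Old e) (outgoing T v)) ((\<lambda>e \<in> edges T. Old e) ` incoming T v)"
    using cover_corolla[OF tree_graft, of "Old v"] outgoing[OF tree v] v
    by (simp add: outgoing_graft incoming_graft)
qed auto

text \<open>The vertices of the grafted tree are the old ones, one over each leaf, and one at the
  bottom. The first kind is handled by the morphism on \<open>T\<close>, the others by
  \<open>top\<close> and \<open>bot\<close>; \<open>notin\<close> completes injectivity at the
  bottom vertex.\<close>

lemma graft_homI:
  assumes Y: "Y \<in> Obj (labeled_trees m)"
    and f: "(\<lambda>e \<in> edges T. g (Old e)) \<in> dend_hom T (fst Y)"
    and ext: "\<And>x. x \<notin> edges G \<Longrightarrow> g x = undefined"
    and new: "\<And>j. j \<in> {1..m} \<Longrightarrow> g (New j) = snd Y j" and root: "g NewRoot = root_edge (fst Y)"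
    and top: "\<And>i. i \<in> {1..n} \<Longrightarrow>
      cover (fst Y) (g (Old (\<chi> i))) (snd Y ` {j \<in> {1..m}. \<phi> (Some j) = Some i})"
    and bot: "cover (fst Y) (root_edge (fst Y))
      (insert (g (Old (root_edge T))) (snd Y ` {j \<in> {1..m}. \<phi> (Some j) = None}))"
    and notin: "g (Old (root_edge T)) \<notin> snd Y ` {j \<in> {1..m}. \<phi> (Some j) = None}"
  shows "g \<in> Hom (labeled_trees m) (graft m n \<phi> X) Y"
proof -
  have S: "is_tree (fst Y)" and b: "bij_betw (snd Y) {1..m} (leaves (fst Y))"
    using Y by (auto simp: obj_labeled)
  have injnew: "inj_on g (New ` {j \<in> {1..m}. P j})" for P
  proof (rule inj_onI)
    fix x y assume "x \<in> New ` {j \<in> {1..m}. P j}" "y \<in> New ` {j \<in> {1..m}. P j}" and eq: "g x = g y"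
    then obtain j k where jk: "x = New j" "y = New k" "j \<in> {1..m}" "k \<in> {1..m}" by blast
    then have "snd Y j = snd Y k" using eq new by simp
    then have "j = k" using bij_betw_imp_inj_on[OF b] jk(3,4) by (simp add: inj_on_eq_iff)
    then show "x = y" using jk by simp
  qed
  have imnew: "g ` New ` {j \<in> {1..m}. P j} = snd Y ` {j \<in> {1..m}. P j}" for P
    unfolding image_image by (rule image_cong) (auto simp: new)
  have "g \<in> dend_hom G (fst Y)"
    unfolding dend_hom_iff[OF S]
  proof (intro conjI ballI)
    have "g x \<in> edges (fst Y)" if "x \<in> edges G" for x
      using that dend_hom_edge[OF f] new label_edge[OF Y] root tree_root[OF S]
      by (cases x) auto
    then show "g \<in> edges G \<rightarrow>\<^sub>E edges (fst Y)" using ext by auto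
  next
    fix w assume w: "w \<in> verts G"
    have "inj_on g (incoming G w) \<and> cover (fst Y) (g (outgoing G w)) (g ` incoming G w)"
    proof (cases w)
      case (Old v)
      then have v: "v \<in> verts T" using w by simp
      let ?f = "\<lambda>e \<in> edges T. g (Old e)"
      have fc: "inj_on ?f (incoming T v)" "cover (fst Y) (?f (outgoing T v)) (?f ` incoming T v)"
        using f v unfolding dend_hom_iff[OF S] by auto
      have eq: "?f e = g (Old e)" if "e \<in> incoming T v" for e
        using that by (auto simp: incoming_def)
      have "?f ` incoming T v = g ` Old ` incoming T v"
        unfolding image_image by (rule image_cong[OF refl eq])
      moreover have "inj_on g (Old ` incoming T v)"
        using fc(1) eq by (auto simp: inj_on_def)
      ultimately show ?thesis using fc(2) outgoing[OF tree v] v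
        by (simp add: Old outgoing_graft incoming_graft)
    next
      case (New i)
      then show ?thesis using w top[of i] injnew imnew
        by (simp add: outgoing_graft incoming_graft)
    next
      case NewRoot
      \<comment> \<open>Removes the set difference that simplifying \<open>inj_on\<close> of an
        inserted element leaves behind.\<close>
      have "New ` B - {Old r} = New ` B" for B and r :: "'a name" by auto
      then show ?thesis using NewRoot bot notin injnew imnew root
        by (simp add: outgoing_graft incoming_graft)
    qed (use w in auto)
    then show "inj_on g (incoming G w)" "cover (fst Y) (g (outgoing G w)) (g ` incoming G w)"
      by auto
  qed
  then show ?thesis
    unfolding hom_labeled using new root label_edge[OF Y] by (auto simp: leaves_graft)
qed

lemma graft_map_hom:
  assumes Y: "Y \<in> Obj (labeled_trees n)" and f: "f \<in> Hom (labeled_trees n) X Y"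
  shows "graft_map m n \<phi> X f \<in> Hom (labeled_trees m) (graft m n \<phi> X) (graft m n \<phi> Y)"
proof -
  interpret Y: grafting m n \<phi> Y by unfold_locales (use Y \<phi> in auto)
  have f': "f \<in> dend_hom T (fst Y)" "f (root_edge T) = root_edge (fst Y)"
    "\<And>i. i \<in> {1..n} \<Longrightarrow> f (\<chi> i) = snd Y i" using f by (auto simp: hom_labeled)
  \<comment> \<open>On old edges \<open>graft_map\<close> is \<open>f\<close> followed by the
    inclusion of the target into its grafting, hence a morphism.\<close>
  have "compose (edges T) (\<lambda>e \<in> edges (fst Y). Old e) f =
      (\<lambda>e \<in> edges T. graft_map m n \<phi> X f (Old e))"
    using dend_hom_edge[OF f'(1)] by (auto simp: compose_def fun_eq_iff)
  then have old: "(\<lambda>e \<in> edges T. graft_map m n \<phi> X f (Old e)) \<in> dend_hom T Y.G"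
    using dend_hom_compose[OF tree Y.tree Y.tree_graft f'(1) Y.graft_inclusion] by simp
  have im: "restrict New {1..m} ` {j \<in> {1..m}. P j} = New ` {j \<in> {1..m}. P j}" for P by force
  show ?thesis
    by (rule graft_homI[OF Y.graft_obj old])
      (use f' label_edge[OF X] tree_root[OF tree] Y.cover_new Y.cover_new_root
        in \<open>auto simp: im graft_map_def\<close>)
qed

end

lemma graft_functor: 
  assumes "\<phi> \<in> Hom Fin_pt m n"
  shows "is_functor (labeled_trees n) (labeled_trees m) (graft_functor m n \<phi>)"
  unfolding is_functor_def graft_functor_def funct.simps
proof (intro conjI ballI)
  fix X :: "'a lgraph" assume X: "X \<in> Obj (labeled_trees n)"
  interpret grafting m n \<phi> X by unfold_locales (use X assms in auto)
  show "graft m n \<phi> X \<in> Obj (labeled_trees m)" by (rule graft_obj)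
  show "graft_map m n \<phi> X (Idn (labeled_trees n) X) = Idn (labeled_trees m) (graft m n \<phi> X)"
    by (rule name_fun_eqI) (auto simp: idn_labeled)
  show "graft_map m n \<phi> X f \<in> Hom (labeled_trees m) (graft m n \<phi> X) (graft m n \<phi> Y)"
    if "Y \<in> Obj (labeled_trees n)" "f \<in> Hom (labeled_trees n) X Y" for Y f
    using graft_map_hom that .
next
  fix X Y Z :: "'a lgraph" and f g
  assume "f \<in> Hom (labeled_trees n) X Y"
  then have "f \<in> dend_hom (fst X) (fst Y)" by (simp add: hom_labeled)
  then show "graft_map m n \<phi> X (Cmp (labeled_trees n) X Y Z g f) =
      Cmp (labeled_trees m) (graft m n \<phi> X) (graft m n \<phi> Y) (graft m n \<phi> Z)
        (graft_map m n \<phi> Y g) (graft_map m n \<phi> X f)"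
    by (intro name_fun_eqI) (auto simp: cmp_labeled compose_def dend_hom_edge)
qed (auto intro: labeled_category)

lemma Idn_hom: "Idn Fin_pt n \<in> Hom Fin_pt n n"
  and Cmp_hom: "\<gamma> \<in> Hom Fin_pt l m \<Longrightarrow> \<phi> \<in> Hom Fin_pt m n \<Longrightarrow> Cmp Fin_pt l m n \<phi> \<gamma> \<in> Hom Fin_pt l n"
proof -
  have "a \<in> Obj Fin_pt" for a by (simp add: Fin_pt_def)
  then show "Idn Fin_pt n \<in> Hom Fin_pt n n"
    "\<gamma> \<in> Hom Fin_pt l m \<Longrightarrow> \<phi> \<in> Hom Fin_pt m n \<Longrightarrow> Cmp Fin_pt l m n \<phi> \<gamma> \<in> Hom Fin_pt l n"
    using Fin_pt_category unfolding is_category_def by blast+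
qed

lemma Idn_value: "j \<in> {1..n} \<Longrightarrow> Idn Fin_pt n (Some j) = Some j"
  and Cmp_value: "j \<in> {1..l} \<Longrightarrow> Cmp Fin_pt l m n \<phi> \<gamma> (Some j) = \<phi> (\<gamma> (Some j))"
  and hom_None: "\<phi> \<in> Hom Fin_pt m n \<Longrightarrow> \<phi> None = None"
  by (auto simp: Fin_pt_def pset_def compose_def)

section \<open>The structure maps of the oplax functor\<close>

text \<open>For the identity every added corolla is unary, and \<open>tau_unit\<close> collapses it
  to a stick, whose cover is the singleton of its root.\<close>

lemma tau_unit_hom:
  assumes X: "X \<in> Obj (labeled_trees n)"
  shows "tau_unit n X \<in> Hom (labeled_trees n) (graft n n (Idn Fin_pt n) X) X"
proof -
  interpret grafting n n "Idn Fin_pt n" X by unfold_locales (use X Idn_hom in auto)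
  have "(\<lambda>e \<in> edges T. tau_unit n X (Old e)) = restrict (\<lambda>e. e) (edges T)" by auto
  then have old: "(\<lambda>e \<in> edges T. tau_unit n X (Old e)) \<in> dend_hom T T"
    using dend_hom_id[OF tree] by simp
  have inv: "{j \<in> {1..n}. Idn Fin_pt n (Some j) = Some i} = {i}" if "i \<in> {1..n}" for i
    using that Idn_value by fastforce
  have inv0: "{j \<in> {1..n}. Idn Fin_pt n (Some j) = None} = {}"
    using Idn_value by fastforce
  show ?thesis
  proof (rule graft_homI[OF X old])
    show "tau_unit n X x = undefined" if "x \<notin> edges G" for x
      using that by (cases x) auto
    show "cover T (tau_unit n X (Old (\<chi> i))) (\<chi> ` {j \<in> {1..n}. Idn Fin_pt n (Some j) = Some i})"
      if "i \<in> {1..n}" for i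
      using inv[OF that] label_edge[OF X that] by (simp add: cover_refl)
    show "cover T (root_edge T) (insert (tau_unit n X (Old (root_edge T)))
        (\<chi> ` {j \<in> {1..n}. Idn Fin_pt n (Some j) = None}))"
      unfolding inv0 using tree_root[OF tree] by (simp add: cover_refl)
    show "tau_unit n X (Old (root_edge T)) \<notin> \<chi> ` {j \<in> {1..n}. Idn Fin_pt n (Some j) = None}"
      unfolding inv0 by simp
  qed simp_all
qed

text \<open>Each new corolla of the grafting along the composite goes to a subtree of the iterated
  grafting: over a leaf, a \<open>\<phi>\<close>-corolla with \<open>\<gamma>\<close>-corollas on
  its inputs; at the bottom, the two bottom corollas stacked, with \<open>\<gamma>\<close>-corollas
  on the new inputs of the inner one. \<open>cover_UN\<close> assembles these.\<close>

lemma tau_comp_hom: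
  assumes X: "X \<in> Obj (labeled_trees n)" and \<gamma>: "\<gamma> \<in> Hom Fin_pt l m" and \<phi>: "\<phi> \<in> Hom Fin_pt m n"
  shows "tau_comp l m n \<gamma> \<phi> X \<in>
    Hom (labeled_trees l) (graft l n (Cmp Fin_pt l m n \<phi> \<gamma>) X) (graft l m \<gamma> (graft m n \<phi> X))"
proof -
  let ?\<psi> = "Cmp Fin_pt l m n \<phi> \<gamma>"
  interpret C: grafting l n ?\<psi> X by unfold_locales (use X Cmp_hom \<gamma> \<phi> in auto)
  interpret A: grafting m n \<phi> X by unfold_locales (use X \<phi> in auto)
  interpret B: grafting l m \<gamma> "graft m n \<phi> X" by unfold_locales (use A.graft_obj \<gamma> in auto)
  have "compose (edges A.T) (\<lambda>e \<in> edges A.G. Old e) (\<lambda>e \<in> edges A.T. Old e) =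
      (\<lambda>e \<in> edges A.T. tau_comp l m n \<gamma> \<phi> X (Old e))"
    by (auto simp: compose_def fun_eq_iff)
  then have old: "(\<lambda>e \<in> edges A.T. tau_comp l m n \<gamma> \<phi> X (Old e)) \<in> dend_hom A.T B.G"
    using dend_hom_compose[OF A.tree A.tree_graft B.tree_graft A.graft_inclusion B.graft_inclusion]
    by simp
  have old_cover: "cover B.G (Old r) (Old ` L)" if "cover A.G r L" for r L
  proof -
    have "(\<lambda>e \<in> edges A.G. Old e) ` L = Old ` L" "r \<in> edges A.G"
      using cover_edges[OF that] that by (force simp: cover_def)+
    then show ?thesis
      using dend_hom_cover(2)[OF A.tree_graft B.tree_graft B.graft_inclusion that] by simp
  qed
  have im: "restrict New {1..l} ` {j \<in> {1..l}. P j} = New ` {j \<in> {1..l}. P j}" for P by force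
  \<comment> \<open>Replaces the leaf \<open>k\<close> of the inner grafting by the inputs of the
    outer corolla over it and leaves all other edges alone.\<close>
  let ?M = "\<lambda>x. case x of Old (New k) \<Rightarrow> New ` {j \<in> {1..l}. \<gamma> (Some j) = Some k} | _ \<Rightarrow> {x}"
  have M: "cover B.G x (?M x)" if "x \<in> edges B.G" for x
    using that B.cover_new cover_refl[OF that]
    by (auto split: name.split)
  have glue: "cover B.G r (\<Union>x\<in>L. ?M x)" if "cover B.G r L" for r L
    by (rule cover_UN[OF B.tree_graft that M]) (use cover_edges[OF that] in blast)
  show ?thesis
  proof (rule C.graft_homI[OF B.graft_obj old])
    show "tau_comp l m n \<gamma> \<phi> X x = undefined" if "x \<notin> edges C.G" for x
      using that by (cases x) auto
    show "cover B.G (tau_comp l m n \<gamma> \<phi> X (Old (A.\<chi> i)))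
        (snd (graft l m \<gamma> (graft m n \<phi> X)) ` {j \<in> {1..l}. ?\<psi> (Some j) = Some i})"
      if i: "i \<in> {1..n}" for i
    proof -
      \<comment> \<open>The fibre of the composite over \<open>i\<close> is the union of the fibres
        of \<open>\<gamma>\<close> over those \<open>k\<close> with \<open>\<phi> k = i\<close>.
        Since \<open>\<phi>\<close> is pointed, no \<open>j\<close> sent to \<open>+\<close> by
        \<open>\<gamma>\<close> contributes.\<close>
      have eq: "(\<Union>x\<in>Old ` New ` {k \<in> {1..m}. \<phi> (Some k) = Some i}. ?M x) =
          New ` {j \<in> {1..l}. ?\<psi> (Some j) = Some i}"
        using Fin_pt_value[OF \<gamma>] hom_None[OF \<phi>] by (force simp: Cmp_value)
      show ?thesis
        using glue[OF old_cover[OF A.cover_new[OF i]], unfolded eq] label_edge[OF X i] by (simp add: im)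
    qed
    \<comment> \<open>First the input \<open>Old NewRoot\<close> of the outer bottom corolla is
      replaced by the inputs of the inner bottom corolla; \<open>?M\<close> then expands the
      latter's new leaves. The labels obtained are those sent to \<open>+\<close> by
      \<open>\<gamma>\<close> or by the composite.\<close>
    have "(\<Union>x\<in>insert (Old NewRoot) (New ` {j \<in> {1..l}. \<gamma> (Some j) = None}). 
         case x of Old NewRoot \<Rightarrow> Old ` insert (Old (root_edge A.T)) (New ` {k \<in> {1..m}. \<phi> (Some k) = None})
           | _ \<Rightarrow> {x}) = 
       insert (Old (Old (root_edge A.T))) (Old ` New ` {k \<in> {1..m}. \<phi> (Some k) = None} \<union>
         New ` {j \<in> {1..l}. \<gamma> (Some j) = None})" (is "?U = ?V")
      by auto
    moreover have "cover B.G NewRoot ?U"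
      by (rule cover_UN[OF B.tree_graft, of _ "insert (Old NewRoot) (New ` {j \<in> {1..l}. \<gamma> (Some j) = None})"])
        (use B.cover_new_root old_cover[OF A.cover_new_root] in \<open>auto intro!: cover_refl\<close>)
    ultimately have "cover B.G NewRoot ?V" by simp
    from glue[OF this]
    have "cover B.G NewRoot (\<Union>x\<in>?V. ?M x)" .
    moreover have "(\<Union>x\<in>?V. ?M x) = 
        insert (Old (Old (root_edge A.T))) (New ` {j \<in> {1..l}. ?\<psi> (Some j) = None})"
      using Fin_pt_value[OF \<gamma>] hom_None[OF \<phi>] by (force simp: Cmp_value)
    ultimately show "cover B.G (root_edge B.G)
        (insert (tau_comp l m n \<gamma> \<phi> X (Old (root_edge A.T)))
          (snd (graft l m \<gamma> (graft m n \<phi> X)) ` {j \<in> {1..l}. ?\<psi> (Some j) = None}))"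
      using tree_root[OF A.tree] by (simp add: im)
  qed (use tree_root[OF A.tree] in \<open>auto simp: im\<close>)
qed

section \<open>The oplax functor\<close>

text \<open>Since morphisms are functions on edges, naturality and coherence are equations of
  functions, checked separately on old edges, new leaves and the new root.\<close>

lemma tree_oplax: "is_oplax_functor Fin_pt
   (tree_oplax :: (nat, nat option \<Rightarrow> nat option, 'a lgraph, 'a name \<Rightarrow> 'a name) oplax_data)"
  unfolding is_oplax_functor_def Let_def tree_oplax_def oplax_data.simps
proof (intro conjI ballI)
  show "is_category Fin_pt" by (rule Fin_pt_category)
  show "is_category (labeled_trees a)" for a by (rule labeled_category)
  show "is_functor (labeled_trees b) (labeled_trees a) (graft_functor a b f)"
    if "f \<in> Hom Fin_pt a b" for a b f using graft_functor that .
next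
  fix a b c f g
  assume f: "f \<in> Hom Fin_pt a b" and g: "g \<in> Hom Fin_pt b c"
  note F = graft_functor[OF f] and H = graft_functor[OF g] and K = graft_functor[OF Cmp_hom[OF f g]]
  have comp: "is_functor (labeled_trees c) (labeled_trees a)
     (comp_functor (graft_functor a b f) (graft_functor b c g)
       :: ('a lgraph, 'a name \<Rightarrow> 'a name, 'a lgraph, 'a name \<Rightarrow> 'a name) funct)"
    using F H unfolding is_functor_def comp_functor_def by auto
  show "is_nat_trans (labeled_trees c) (labeled_trees a)
     (graft_functor a c (Cmp Fin_pt a b c g f))
     (comp_functor (graft_functor a b f) (graft_functor b c g))
     (tau_comp a b c f g :: 'a lgraph \<Rightarrow> 'a name \<Rightarrow> 'a name)"
    unfolding is_nat_trans_def
  proof (intro conjI ballI comp K)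
    show "tau_comp a b c f g X \<in> Hom (labeled_trees a)
        (OnOb (graft_functor a c (Cmp Fin_pt a b c g f)) X)
        (OnOb (comp_functor (graft_functor a b f) (graft_functor b c g)) X)"
      if "X \<in> Obj (labeled_trees c)" for X :: "'a lgraph"
      using tau_comp_hom[OF that f g] by (simp add: graft_functor_def comp_functor_def)
  next
    fix X Y :: "'a lgraph" and h
    assume "h \<in> Hom (labeled_trees c) X Y"
    then have "h \<in> dend_hom (fst X) (fst Y)" by (simp add: hom_labeled)
    then show "Cmp (labeled_trees a) (OnOb (graft_functor a c (Cmp Fin_pt a b c g f)) X)
        (OnOb (graft_functor a c (Cmp Fin_pt a b c g f)) Y)
        (OnOb (comp_functor (graft_functor a b f) (graft_functor b c g)) Y)
        (tau_comp a b c f g Y) (OnHom (graft_functor a c (Cmp Fin_pt a b c g f)) X Y h) =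
      Cmp (labeled_trees a) (OnOb (graft_functor a c (Cmp Fin_pt a b c g f)) X)
        (OnOb (comp_functor (graft_functor a b f) (graft_functor b c g)) X)
        (OnOb (comp_functor (graft_functor a b f) (graft_functor b c g)) Y)
        (OnHom (comp_functor (graft_functor a b f) (graft_functor b c g)) X Y h) (tau_comp a b c f g X)"
      by (intro name_fun_eqI)
        (auto simp: graft_functor_def comp_functor_def cmp_labeled compose_def dend_hom_edge)
  qed
next
  fix a
  note K = graft_functor[OF Idn_hom, of a]
  have id: "is_functor (labeled_trees a) (labeled_trees a)
     (id_functor :: ('a lgraph, 'a name \<Rightarrow> 'a name, 'a lgraph, 'a name \<Rightarrow> 'a name) funct)"
    using labeled_category unfolding is_functor_def id_functor_def by auto
  show "is_nat_trans (labeled_trees a) (labeled_trees a) (graft_functor a a (Idn Fin_pt a))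
      id_functor (tau_unit a :: 'a lgraph \<Rightarrow> 'a name \<Rightarrow> 'a name)"
    unfolding is_nat_trans_def
  proof (intro conjI ballI id K)
    show "tau_unit a X \<in> Hom (labeled_trees a) (OnOb (graft_functor a a (Idn Fin_pt a)) X) (OnOb id_functor X)"
      if "X \<in> Obj (labeled_trees a)" for X :: "'a lgraph"
      using tau_unit_hom[OF that] by (simp add: graft_functor_def id_functor_def)
  next
    fix X Y :: "'a lgraph" and h
    assume XY: "X \<in> Obj (labeled_trees a)" "h \<in> Hom (labeled_trees a) X Y"
    \<comment> \<open>Naturality on the new leaves and the new root says exactly that
      \<open>h\<close> respects labels and root.\<close>
    then have h: "h \<in> dend_hom (fst X) (fst Y)" "h (root_edge (fst X)) = root_edge (fst Y)"
      "\<And>i. i \<in> {1..a} \<Longrightarrow> h (snd X i) = snd Y i" by (auto simp: hom_labeled)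
    show "Cmp (labeled_trees a) (OnOb (graft_functor a a (Idn Fin_pt a)) X)
        (OnOb (graft_functor a a (Idn Fin_pt a)) Y) (OnOb id_functor Y)
        (tau_unit a Y) (OnHom (graft_functor a a (Idn Fin_pt a)) X Y h) =
      Cmp (labeled_trees a) (OnOb (graft_functor a a (Idn Fin_pt a)) X)
        (OnOb id_functor X) (OnOb id_functor Y)
        (OnHom id_functor X Y h) (tau_unit a X)"
      by (intro name_fun_eqI)
        (use h in \<open>auto simp: graft_functor_def id_functor_def cmp_labeled compose_def dend_hom_edge\<close>)
  qed
\<comment> \<open>What remains are the associativity and unit coherence equations.\<close>
qed (auto intro!: name_fun_eqI simp: graft_functor_def cmp_labeled idn_labeled compose_def)

section \<open>Fully faithful functors\<close>

text \<open>An assignment injective on hom-sets pulls the unit and associativity laws back from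
  \<open>C\<close>, so \<open>D\<close> need not be known to be a category. This spares a direct
  verification for the Grothendieck construction.\<close>

lemma faithful_is_functor:
  assumes C: "is_category C"
    and ob: "\<And>x. x \<in> Obj D \<Longrightarrow> OnOb U x \<in> Obj C"
    and hom: "\<And>x y f. x \<in> Obj D \<Longrightarrow> y \<in> Obj D \<Longrightarrow> f \<in> Hom D x y \<Longrightarrow> OnHom U x y f \<in> Hom C (OnOb U x) (OnOb U y)"
    and inj: "\<And>x y. x \<in> Obj D \<Longrightarrow> y \<in> Obj D \<Longrightarrow> inj_on (OnHom U x y) (Hom D x y)"
    and idn: "\<And>x. x \<in> Obj D \<Longrightarrow> Idn D x \<in> Hom D x x"
      "\<And>x. x \<in> Obj D \<Longrightarrow> OnHom U x x (Idn D x) = Idn C (OnOb U x)"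
    and cmp: "\<And>x y z f g. x \<in> Obj D \<Longrightarrow> y \<in> Obj D \<Longrightarrow> z \<in> Obj D \<Longrightarrow> f \<in> Hom D x y \<Longrightarrow> g \<in> Hom D y z \<Longrightarrow>
        Cmp D x y z g f \<in> Hom D x z"
      "\<And>x y z f g. x \<in> Obj D \<Longrightarrow> y \<in> Obj D \<Longrightarrow> z \<in> Obj D \<Longrightarrow> f \<in> Hom D x y \<Longrightarrow> g \<in> Hom D y z \<Longrightarrow>
        OnHom U x z (Cmp D x y z g f) = Cmp C (OnOb U x) (OnOb U y) (OnOb U z) (OnHom U y z g) (OnHom U x y f)"
  shows "is_functor D C U"
proof -
  have C1: "Cmp C a a b f (Idn C a) = f" "Cmp C a b b (Idn C b) f = f"
    if "a \<in> Obj C" "b \<in> Obj C" "f \<in> Hom C a b" for a b f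
    using C that unfolding is_category_def by blast+
  have C2: "Cmp C a c d h (Cmp C a b c g f) = Cmp C a b d (Cmp C b c d h g) f"
    if "a \<in> Obj C" "b \<in> Obj C" "c \<in> Obj C" "d \<in> Obj C" "f \<in> Hom C a b" "g \<in> Hom C b c" "h \<in> Hom C c d"
    for a b c d f g h
    using C that unfolding is_category_def by blast
  have eqI: "f = g" if "x \<in> Obj D" "y \<in> Obj D" "f \<in> Hom D x y" "g \<in> Hom D x y" "OnHom U x y f = OnHom U x y g"
    for x y f g using inj that by (meson inj_onD)
  have "is_category D"
    unfolding is_category_def
  proof (intro conjI ballI)
    fix x y f assume x: "x \<in> Obj D" "y \<in> Obj D" "f \<in> Hom D x y"
    show "Cmp D x x y f (Idn D x) = f"
      by (rule eqI[of x y]) (use x in \<open>simp_all add: cmp idn ob hom C1\<close>)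
    show "Cmp D x y y (Idn D y) f = f"
      by (rule eqI[of x y]) (use x in \<open>simp_all add: cmp idn ob hom C1\<close>)
  next
    fix a b c d f g h
    assume *: "a \<in> Obj D" "b \<in> Obj D" "c \<in> Obj D" "d \<in> Obj D" "f \<in> Hom D a b" "g \<in> Hom D b c" "h \<in> Hom D c d"
    show "Cmp D a c d h (Cmp D a b c g f) = Cmp D a b d (Cmp D b c d h g) f"
    proof (rule eqI[of a d])
      show "OnHom U a d (Cmp D a c d h (Cmp D a b c g f)) = OnHom U a d (Cmp D a b d (Cmp D b c d h g) f)"
        using * C2[OF ob[of a] ob[of b] ob[of c] ob[of d] hom[of a b f] hom[of b c g] hom[of c d h]]
          cmp(1)[of a b c f g] cmp(1)[of b c d g h] by (simp add: cmp(2))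
    qed (use * cmp(1)[of a b c f g] cmp(1)[of b c d g h] in \<open>simp_all add: cmp(1)\<close>)
  qed (use idn cmp in auto)
  then show ?thesis unfolding is_functor_def using C ob hom idn cmp by simp
qed

text \<open>The quasi-inverse is \<open>S\<close> on objects and the inverse of the bijection of
  hom-sets on morphisms. All its laws are checked after applying the faithful
  \<open>U\<close>.\<close>

lemma equivalent_if_fully_faithful:
  fixes C :: "('o, 'm) cat" and D :: "('p, 'n) cat"
  assumes U: "is_functor D C U"
    and bij: "\<And>x y. x \<in> Obj D \<Longrightarrow> y \<in> Obj D \<Longrightarrow>
      bij_betw (OnHom U x y) (Hom D x y) (Hom C (OnOb U x) (OnOb U y))"
    and sec: "\<And>c. c \<in> Obj C \<Longrightarrow> S c \<in> Obj D" "\<And>c. c \<in> Obj C \<Longrightarrow> OnOb U (S c) = c"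
  shows "equivalent_categories C D"
proof -
  have C: "is_category C" and D: "is_category D" using U by (auto simp: is_functor_def)
  have Uob: "OnOb U x \<in> Obj C" if "x \<in> Obj D" for x using U that by (simp add: is_functor_def)
  have Uid: "OnHom U x x (Idn D x) = Idn C (OnOb U x)" if "x \<in> Obj D" for x
    using U that by (simp add: is_functor_def)
  have Ucmp: "OnHom U x z (Cmp D x y z g f) =
      Cmp C (OnOb U x) (OnOb U y) (OnOb U z) (OnHom U y z g) (OnHom U x y f)"
    if "x \<in> Obj D" "y \<in> Obj D" "z \<in> Obj D" "f \<in> Hom D x y" "g \<in> Hom D y z" for x y z f g
    using U that by (simp add: is_functor_def)
  have Cid: "Idn C a \<in> Hom C a a" if "a \<in> Obj C" for a using C that by (simp add: is_category_def)
  have Did: "Idn D a \<in> Hom D a a" if "a \<in> Obj D" for a using D that by (simp add: is_category_def)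
  have Cunit: "Cmp C a a b f (Idn C a) = f" "Cmp C a b b (Idn C b) f = f"
    if "a \<in> Obj C" "b \<in> Obj C" "f \<in> Hom C a b" for a b f
    using C that unfolding is_category_def by blast+
  have Ccmp: "Cmp C a b c g f \<in> Hom C a c"
    if "a \<in> Obj C" "b \<in> Obj C" "c \<in> Obj C" "f \<in> Hom C a b" "g \<in> Hom C b c" for a b c f g
    using C that unfolding is_category_def by blast
  have Dcmp: "Cmp D a b c g f \<in> Hom D a c"
    if "a \<in> Obj D" "b \<in> Obj D" "c \<in> Obj D" "f \<in> Hom D a b" "g \<in> Hom D b c" for a b c f g
    using D that unfolding is_category_def by blast
  define lift where "lift x y = inv_into (Hom D x y) (OnHom U x y)" for x y
  have lift: "lift x y f \<in> Hom D x y" "OnHom U x y (lift x y f) = f"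
    if "x \<in> Obj D" "y \<in> Obj D" "f \<in> Hom C (OnOb U x) (OnOb U y)" for x y f
  proof -
    have "f \<in> OnHom U x y ` Hom D x y" using bij that by (simp add: bij_betw_def)
    then show "lift x y f \<in> Hom D x y" "OnHom U x y (lift x y f) = f"
      unfolding lift_def by (auto intro: inv_into_into f_inv_into_f)
  qed
  have Uhom: "OnHom U x y f \<in> Hom C (OnOb U x) (OnOb U y)" if "x \<in> Obj D" "y \<in> Obj D" "f \<in> Hom D x y" for x y f
    using U that by (simp add: is_functor_def)
  have eqI: "f = g" if "x \<in> Obj D" "y \<in> Obj D" "f \<in> Hom D x y" "g \<in> Hom D x y" "OnHom U x y f = OnHom U x y g"
    for x y f g using bij_betw_imp_inj_on[OF bij] that by (meson inj_onD)
  define F where "F = \<lparr>OnOb = S, OnHom = (\<lambda>a b. lift (S a) (S b))\<rparr>"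
  have liftS: "lift (S a) (S b) f \<in> Hom D (S a) (S b)" "OnHom U (S a) (S b) (lift (S a) (S b) f) = f"
    if "a \<in> Obj C" "b \<in> Obj C" "f \<in> Hom C a b" for a b f
    using lift[of "S a" "S b" f] that by (auto simp: sec)
  have F: "is_functor C D F"
    unfolding is_functor_def F_def funct.simps
  proof (intro conjI ballI C D)
    fix a b c f g
    assume *: "a \<in> Obj C" "b \<in> Obj C" "c \<in> Obj C" "f \<in> Hom C a b" "g \<in> Hom C b c"
    show "lift (S a) (S c) (Cmp C a b c g f) =
        Cmp D (S a) (S b) (S c) (lift (S b) (S c) g) (lift (S a) (S b) f)"
      by (rule eqI[of "S a" "S c"]) (use * in \<open>simp_all add: sec liftS Ccmp Dcmp Ucmp\<close>)
  next
    fix a assume "a \<in> Obj C"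
    then show "lift (S a) (S a) (Idn C a) = Idn D (S a)"
      by (intro eqI[of "S a" "S a"]) (simp_all add: sec liftS Cid Did Uid)
  qed (simp_all add: sec liftS)
  have UF: "is_functor C C (comp_functor U F)" and FU: "is_functor D D (comp_functor F U)"
    using U F unfolding is_functor_def comp_functor_def by auto
  have idC: "is_functor C C id_functor" and idD: "is_functor D D id_functor"
    using C D unfolding is_functor_def id_functor_def by auto
  \<comment> \<open>As \<open>U\<close> returns \<open>S c\<close> to \<open>c\<close> itself, the
    composite acts as the identity on \<open>C\<close>, and identities are the components.\<close>
  have s: "is_nat_iso C C (comp_functor U F) id_functor (Idn C)"
    unfolding is_nat_iso_def is_nat_trans_def is_iso_def
    using UF idC by (auto simp: comp_functor_def id_functor_def F_def sec liftS Cid Cunit intro!: bexI[of _ "Idn C _"])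
  \<comment> \<open>The objects \<open>S (OnOb U x)\<close> and \<open>x\<close> have the same image
    under \<open>U\<close>; \<open>t\<close> and \<open>t'\<close> lift its identity in both
    directions.\<close>
  define t where "t x = lift (S (OnOb U x)) x (Idn C (OnOb U x))" for x
  define t' where "t' x = lift x (S (OnOb U x)) (Idn C (OnOb U x))" for x
  have t: "t x \<in> Hom D (S (OnOb U x)) x" "OnHom U (S (OnOb U x)) x (t x) = Idn C (OnOb U x)"
    "t' x \<in> Hom D x (S (OnOb U x))" "OnHom U x (S (OnOb U x)) (t' x) = Idn C (OnOb U x)"
    if "x \<in> Obj D" for x
    using that lift[of "S (OnOb U x)" x "Idn C (OnOb U x)"] lift[of x "S (OnOb U x)" "Idn C (OnOb U x)"]
    by (simp_all add: sec Uob Cid t_def t'_def)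
  have "is_nat_iso D D (comp_functor F U) id_functor t"
    unfolding is_nat_iso_def is_nat_trans_def
  proof (intro conjI ballI FU idD)
    fix x assume x: "x \<in> Obj D"
    show tx: "t x \<in> Hom D (OnOb (comp_functor F U) x) (OnOb id_functor x)"
      using t x by (simp add: comp_functor_def id_functor_def F_def)
    let ?x = "S (OnOb U x)"
    have "Cmp D ?x x ?x (t' x) (t x) = Idn D ?x"
      by (rule eqI[of ?x ?x])
        (use x t[OF x] in \<open>simp_all add: sec Uob Dcmp Did Ucmp Uid Cid Cunit\<close>)
    moreover have "Cmp D x ?x x (t x) (t' x) = Idn D x"
      by (rule eqI[of x x])
        (use x t[OF x] in \<open>simp_all add: sec Uob Dcmp Did Ucmp Uid Cid Cunit\<close>)
    ultimately show "is_iso D (OnOb (comp_functor F U) x) (OnOb id_functor x) (t x)"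
      unfolding is_iso_def using tx t(3)[OF x] by (auto simp: comp_functor_def id_functor_def F_def)
  next
    fix x y f assume x: "x \<in> Obj D" and y: "y \<in> Obj D" and f: "f \<in> Hom D x y"
    let ?x = "S (OnOb U x)" and ?y = "S (OnOb U y)"
    have "Cmp D ?x ?y y (t y) (lift ?x ?y (OnHom U x y f)) = Cmp D ?x x y f (t x)"
      by (rule eqI[of ?x y])
        (use x y f t[OF x] t[OF y] Uhom[OF x y f] in \<open>simp_all add: sec Uob Dcmp Ucmp liftS Cunit\<close>)
    then show "Cmp D (OnOb (comp_functor F U) x) (OnOb (comp_functor F U) y) (OnOb id_functor y) (t y)
         (OnHom (comp_functor F U) x y f) =
        Cmp D (OnOb (comp_functor F U) x) (OnOb id_functor x) (OnOb id_functor y)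
         (OnHom id_functor x y f) (t x)"
      by (simp add: comp_functor_def id_functor_def F_def)
  qed
  with U F s show ?thesis unfolding equivalent_categories_def by blast
qed

section \<open>The Grothendieck construction\<close>

context grafting
begin

lemma hom_new:
  assumes "\<alpha> \<in> Hom (labeled_trees m) (graft m n \<phi> X) Y"
  shows "j \<in> {1..m} \<Longrightarrow> \<alpha> (New j) = snd Y j" "\<alpha> NewRoot = root_edge (fst Y)"
  using assms by (auto simp: hom_labeled)

lemma hom_restrict:
  assumes Y: "Y \<in> Obj (labeled_trees m)" and \<alpha>: "\<alpha> \<in> Hom (labeled_trees m) (graft m n \<phi> X) Y"
  shows "(\<lambda>e \<in> edges T. \<alpha> (Old e)) \<in> dend_hom T (fst Y)"
proof -
  have "is_tree (fst Y)" "\<alpha> \<in> dend_hom G (fst Y)" using Y \<alpha> by (auto simp: obj_labeled hom_labeled)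
  from dend_hom_compose[OF tree tree_graft this(1) graft_inclusion this(2)]
  show ?thesis by (simp add: compose_def cong: restrict_cong)
qed

text \<open>This is how \<open>\<alpha>\<close> on old edges determines \<open>\<phi>\<close>. In
  the grafted tree the new leaves above the old leaf \<open>i\<close> are the inputs of its corolla.
  Morphisms preserve the order and reflect comparability, and nothing else lies above a
  leaf.\<close>

lemma hom_label_iff:
  assumes Y: "Y \<in> Obj (labeled_trees m)" and \<alpha>: "\<alpha> \<in> Hom (labeled_trees m) (graft m n \<phi> X) Y"
    and i: "i \<in> {1..n}" and j: "j \<in> {1..m}"
  shows "\<phi> (Some j) = Some i \<longleftrightarrow> below (fst Y) (\<alpha> (Old (\<chi> i))) (snd Y j)"
proof -
  have S: "is_tree (fst Y)" and a: "\<alpha> \<in> dend_hom G (fst Y)"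
    using Y \<alpha> by (auto simp: obj_labeled hom_labeled)
  have e: "Old (\<chi> i) \<in> edges G" "New j \<in> edges G" using i j label_edge[OF X] by auto
  have leaf: "New k \<in> leaves G" if "k \<in> {1..m}" for k using that by (simp add: leaves_graft)
  have child: "child G (Old (\<chi> i)) b \<longleftrightarrow> b \<in> New ` {j \<in> {1..m}. \<phi> (Some j) = Some i}" for b
    using child_incoming[OF tree_graft e(1) upper_label[OF i]] by (simp add: incoming_graft)
  have "\<phi> (Some j) = Some i \<longleftrightarrow> below G (Old (\<chi> i)) (New j)"
  proof
    assume "\<phi> (Some j) = Some i"
    then show "below G (Old (\<chi> i)) (New j)" using child j by blast
  next
    assume "below G (Old (\<chi> i)) (New j)"
    then obtain b where b: "child G (Old (\<chi> i)) b" "below G b (New j)"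
      by (cases rule: converse_rtranclpE) auto
    then obtain k where "k \<in> {1..m}" "b = New k" "\<phi> (Some k) = Some i" using child by blast
    then show "\<phi> (Some j) = Some i" using leaf_below[OF leaf] b(2) by blast
  qed
  also have "\<dots> \<longleftrightarrow> below (fst Y) (\<alpha> (Old (\<chi> i))) (\<alpha> (New j))"
  proof
    show "below G (Old (\<chi> i)) (New j) \<Longrightarrow> below (fst Y) (\<alpha> (Old (\<chi> i))) (\<alpha> (New j))"
      by (rule dend_hom_below[OF tree_graft S a])
    assume "below (fst Y) (\<alpha> (Old (\<chi> i))) (\<alpha> (New j))"
    then have "below G (Old (\<chi> i)) (New j) \<or> below G (New j) (Old (\<chi> i))"
      by (rule dend_hom_comparable[OF tree_graft S a e])
    then show "below G (Old (\<chi> i)) (New j)" using leaf_below[OF leaf[OF j]] by blast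
  qed
  finally show ?thesis using hom_new(1)[OF \<alpha> j] by simp
qed

end

text \<open>Faithfulness of the restriction to old edges: \<open>\<alpha>\<close> is forced on new
  edges by labels and root, and \<open>\<phi>\<close> is recovered by
  \<open>hom_label_iff\<close>.\<close>

lemma graft_hom_eq:
  assumes X: "X \<in> Obj (labeled_trees n)" and Y: "Y \<in> Obj (labeled_trees m)"
    and \<phi>: "\<phi> \<in> Hom Fin_pt m n" "\<phi>' \<in> Hom Fin_pt m n"
    and \<alpha>: "\<alpha> \<in> Hom (labeled_trees m) (graft m n \<phi> X) Y"
      "\<alpha>' \<in> Hom (labeled_trees m) (graft m n \<phi>' X) Y"
    and eq: "\<And>e. e \<in> edges (fst X) \<Longrightarrow> \<alpha> (Old e) = \<alpha>' (Old e)"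
  shows "\<phi> = \<phi>'" "\<alpha> = \<alpha>'"
proof -
  interpret A: grafting m n \<phi> X by unfold_locales (use X \<phi> in auto)
  interpret B: grafting m n \<phi>' X by unfold_locales (use X \<phi> in auto)
  have a: "\<alpha> \<in> dend_hom A.G (fst Y)" "\<alpha>' \<in> dend_hom B.G (fst Y)"
    using \<alpha> by (auto simp: hom_labeled)
  show "\<alpha> = \<alpha>'"
  proof
    fix x
    show "\<alpha> x = \<alpha>' x"
    proof (cases "x \<in> edges A.G")
      case True
      then show ?thesis
        using eq A.hom_new[OF \<alpha>(1)] B.hom_new[OF \<alpha>(2)] by (cases x) auto
    next
      case False
      \<comment> \<open>The pointed function influences only the incidences, so both maps are
        undefined at the same arguments.\<close>
      moreover have "edges B.G = edges A.G" by (simp add: edges_graft)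
      ultimately show ?thesis using dend_hom_undefined[OF a(1)] dend_hom_undefined[OF a(2)] by simp
    qed
  qed
  show "\<phi> = \<phi>'"
  proof
    fix x
    consider "x = None" | j where "j \<in> {1..m}" "x = Some j" | "x \<notin> pset m"
      by (cases x) (force simp: pset_def)+
    then show "\<phi> x = \<phi>' x"
    proof cases
      case 1
      then show ?thesis using hom_None \<phi> by metis
    next
      case 2
      have "\<phi> (Some j) = Some i \<longleftrightarrow> \<phi>' (Some j) = Some i" if "i \<in> {1..n}" for i
        using A.hom_label_iff[OF Y \<alpha>(1) that 2(1)] B.hom_label_iff[OF Y \<alpha>(2) that 2(1)]
          eq label_edge[OF X that] by simp
      then show ?thesis
        using Fin_pt_value[OF \<phi>(1) 2(1)] Fin_pt_value[OF \<phi>(2) 2(1)] 2(2) by metis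
    next
      case 3
      then show ?thesis using \<phi> PiE_arb[of \<phi> "pset m" "\<lambda>_. pset n" x]
        PiE_arb[of \<phi>' "pset m" "\<lambda>_. pset n" x] by (simp add: Fin_pt_def)
    qed
  qed
qed

text \<open>Fullness of the restriction to old edges. The function \<open>\<phi>\<close> sends
  \<open>j\<close> to the leaf of \<open>X\<close> whose image lies below the leaf \<open>j\<close>
  of \<open>Y\<close>, and to \<open>+\<close> if there is none.\<close>

lemma graft_hom_ex:
  fixes X Y :: "'a lgraph"
  assumes X: "X \<in> Obj (labeled_trees n)" and Y: "Y \<in> Obj (labeled_trees m)"
    and f: "f \<in> dend_hom (fst X) (fst Y)"
  obtains \<phi> \<alpha> where "\<phi> \<in> Hom Fin_pt m n" "\<alpha> \<in> Hom (labeled_trees m) (graft m n \<phi> X) Y"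
    "(\<lambda>e \<in> edges (fst X). \<alpha> (Old e)) = f"
proof -
  let ?P = "\<lambda>j i. i \<in> {1..n} \<and> below (fst Y) (f (snd X i)) (snd Y j)"
  define \<phi> where "\<phi> = restrict (\<lambda>x. case x of None \<Rightarrow> None
    | Some j \<Rightarrow> if \<exists>i. ?P j i then Some (SOME i. ?P j i) else None) (pset m)"
  have T: "is_tree (fst X)" and S: "is_tree (fst Y)" and bX: "bij_betw (snd X) {1..n} (leaves (fst X))"
    and bY: "bij_betw (snd Y) {1..m} (leaves (fst Y))"
    using X Y by (auto simp: obj_labeled)
  \<comment> \<open>The images lie below a common leaf, hence are comparable. Then so are the leaves
    of \<open>X\<close>, which forces them to be equal.\<close>
  have uniq: "i = i'" if "?P j i" "?P j i'" for i i' j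
  proof -
    have "below (fst Y) (f (snd X i)) (f (snd X i')) \<or> below (fst Y) (f (snd X i')) (f (snd X i))"
      using below_linear[OF S] that by blast
    then have "below (fst X) (snd X i) (snd X i') \<or> below (fst X) (snd X i') (snd X i)"
      using dend_hom_comparable[OF T S f] label_edge[OF X] that by blast
    then have "snd X i = snd X i'"
      using leaf_below label_edge[OF X] that by metis
    then show ?thesis using bX that by (meson bij_betw_imp_inj_on inj_onD)
  qed
  have some: "\<phi> (Some j) = Some i \<longleftrightarrow> ?P j i" if "j \<in> {1..m}" for i j
  proof -
    have "?P j i \<Longrightarrow> (SOME i. ?P j i) = i" by (rule some_equality) (use uniq in blast)+
    moreover have "?P j (SOME i. ?P j i)" if "\<exists>i. ?P j i" using someI_ex[OF that] .
    ultimately show ?thesis using that by (auto simp: \<phi>_def pset_def)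
  qed
  have \<phi>: "\<phi> \<in> Hom Fin_pt m n"
  proof -
    have none: "\<phi> None = None" by (simp add: \<phi>_def pset_def)
    have "\<phi> x \<in> pset n" if x: "x \<in> pset m" for x
    proof (cases "\<phi> x")
      case (Some i)
      then have "x \<noteq> None" using none by (metis option.distinct(1))
      then obtain j where "x = Some j" "j \<in> {1..m}" using x by (auto simp: pset_def)
      then have "i \<in> {1..n}" using some[of j i] Some by blast
      then show ?thesis by (simp add: Some pset_def)
    qed (simp add: pset_def)
    moreover have "\<phi> \<in> extensional (pset m)" by (simp add: \<phi>_def)
    ultimately show ?thesis using none by (auto simp: Fin_pt_def PiE_def)
  qed
  interpret grafting m n \<phi> X by unfold_locales (use X \<phi> in auto)
  define \<alpha> where "\<alpha> = restrict (\<lambda>x. case x of Old e \<Rightarrow> f e | New j \<Rightarrow> snd Y j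
    | NewRoot \<Rightarrow> root_edge (fst Y) | Atom a \<Rightarrow> Atom a) (edges G)"
  have old: "\<alpha> (Old e) = f e" if "e \<in> edges T" for e using that by (simp add: \<alpha>_def)
  have res: "(\<lambda>e \<in> edges T. \<alpha> (Old e)) = f"
    using old dend_hom_undefined[OF f] by (auto simp: fun_eq_iff)
  have img: "snd Y ` {j \<in> {1..m}. P (snd Y j)} = {x \<in> leaves (fst Y). P x}" for P
    unfolding bij_betw_imp_surj_on[OF bY, symmetric] by blast
  let ?r = "f (root_edge T)"
  have r: "?r \<in> edges (fst Y)" using dend_hom_edge[OF f tree_root[OF tree]] .
  have "cover (fst X) (root_edge T) (leaves T)"
  proof -
    have "leaves T = {x \<in> leaves T. below T (root_edge T) x}"
      using root_below[OF tree] by (auto simp: leaves_def)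
    then show ?thesis using cover_leaves[OF tree_root[OF tree]] by simp
  qed
  then have cr: "cover (fst Y) ?r (f ` leaves T)" by (rule dend_hom_cover(2)[OF T S f])
  \<comment> \<open>The leaves of \<open>T\<close> cover its root, so their images cover
    \<open>?r\<close>. Thus a leaf of \<open>Y\<close> is above the image of some leaf of
    \<open>T\<close> iff it is above \<open>?r\<close>.\<close>
  have none: "\<phi> (Some j) = None \<longleftrightarrow> \<not> below (fst Y) ?r (snd Y j)" if j: "j \<in> {1..m}" for j
  proof -
    have "\<phi> (Some j) = None \<longleftrightarrow> (\<forall>i. \<not> ?P j i)"
      unfolding some[OF j, symmetric] by (cases "\<phi> (Some j)") auto
    also have "\<dots> \<longleftrightarrow> \<not> (\<exists>l \<in> f ` leaves T. below (fst Y) l (snd Y j))"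
      unfolding bij_betw_imp_surj_on[OF bX, symmetric] by blast
    also have "\<dots> \<longleftrightarrow> \<not> below (fst Y) ?r (snd Y j)"
      using cr label_edge(1)[OF Y j] unfolding cover_def by (meson rtranclp_trans)
    finally show ?thesis .
  qed
  have im_none: "snd Y ` {j \<in> {1..m}. \<phi> (Some j) = None} = {x \<in> leaves (fst Y). \<not> below (fst Y) ?r x}"
    unfolding img[of "\<lambda>x. \<not> below (fst Y) ?r x", symmetric] using none by (intro arg_cong[of _ _ "image (snd Y)"]) auto
  have im_some: "snd Y ` {j \<in> {1..m}. \<phi> (Some j) = Some i} =
      {x \<in> leaves (fst Y). below (fst Y) (f (\<chi> i)) x}" if "i \<in> {1..n}" for i
    unfolding img[of "\<lambda>x. below (fst Y) (f (\<chi> i)) x", symmetric] using some that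
    by (intro arg_cong[of _ _ "image (snd Y)"]) auto
  \<comment> \<open>The corolla over a leaf goes to the subtree containing everything above its
    image. The bottom corolla goes to the part of \<open>Y\<close> not strictly above
    \<open>?r\<close>, whose leaves are \<open>?r\<close> and the leaves of \<open>Y\<close> not
    above it.\<close>
  have "\<alpha> \<in> Hom (labeled_trees m) (graft m n \<phi> X) Y"
  proof (rule graft_homI[OF Y])
    show "(\<lambda>e \<in> edges T. \<alpha> (Old e)) \<in> dend_hom T (fst Y)" using f res by simp
    show "cover (fst Y) (\<alpha> (Old (\<chi> i))) (snd Y ` {j \<in> {1..m}. \<phi> (Some j) = Some i})"
      if "i \<in> {1..n}" for i
      unfolding im_some[OF that] old[OF label_edge(2)[OF X that]]
      by (rule cover_leaves) (rule dend_hom_edge[OF f label_edge(2)[OF X that]])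
    show "cover (fst Y) (root_edge (fst Y)) (insert (\<alpha> (Old (root_edge T)))
        (snd Y ` {j \<in> {1..m}. \<phi> (Some j) = None}))"
      unfolding im_none old[OF tree_root[OF tree]] cover_def
    proof (intro conjI ballI impI)
      show "below (fst Y) (root_edge (fst Y)) l"
        if "l \<in> insert ?r {x \<in> leaves (fst Y). \<not> below (fst Y) ?r x}" for l
        using that r by (intro root_below[OF S]) (auto simp: leaves_def)
      show "l = l'"
        if "l \<in> insert ?r {x \<in> leaves (fst Y). \<not> below (fst Y) ?r x}"
          "l' \<in> insert ?r {x \<in> leaves (fst Y). \<not> below (fst Y) ?r x}" "below (fst Y) l l'" for l l'
        using that leaf_below[of l "fst Y" l'] by blast
      show "\<exists>l \<in> insert ?r {x \<in> leaves (fst Y). \<not> below (fst Y) ?r x}. below (fst Y) l x"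
        if "x \<in> leaves (fst Y)" for x
        using that by blast
    qed (rule tree_root[OF S])
    show "\<alpha> (Old (root_edge T)) \<notin> snd Y ` {j \<in> {1..m}. \<phi> (Some j) = None}"
      unfolding im_none old[OF tree_root[OF tree]] by simp
  qed (simp_all add: \<alpha>_def)
  with \<phi> res show thesis using that by blast
qed

section \<open>Forgetting the labels\<close>

abbreviation (input) tree_groth ::
    "(nat \<times> 'a lgraph, (nat option \<Rightarrow> nat option) \<times> ('a name \<Rightarrow> 'a name)) cat" where
  "tree_groth \<equiv> grothendieck Fin_pt tree_oplax"

lemma groth_obj: "(n, X) \<in> Obj tree_groth \<longleftrightarrow> X \<in> Obj (labeled_trees n)"
  by (simp add: grothendieck_def tree_oplax_def Fin_pt_def)

lemma groth_hom: "(\<phi>, \<alpha>) \<in> Hom tree_groth (n, X) (m, Y) \<longleftrightarrow>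
    \<phi> \<in> Hom Fin_pt m n \<and> \<alpha> \<in> Hom (labeled_trees m) (graft m n \<phi> X) Y"
  by (simp add: grothendieck_def tree_oplax_def graft_functor_def)

lemma groth_idn: "Idn tree_groth (n, X) = (Idn Fin_pt n, tau_unit n X)"
  by (simp add: grothendieck_def tree_oplax_def)

lemma groth_cmp: "Cmp tree_groth (a, X) (b, Y) (c, Z) (g, \<beta>) (f, \<alpha>) =
   (let fg = Cmp Fin_pt c b a f g; V = graft c a fg X; W = graft c b g (graft b a f X) in
    (fg, Cmp (labeled_trees c) V (graft c b g Y) Z \<beta>
        (Cmp (labeled_trees c) V W (graft c b g Y) (graft_map c b g (graft b a f X) \<alpha>) (tau_comp c b a g f X))))"
  by (simp add: grothendieck_def tree_oplax_def graft_functor_def Let_def)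

definition forget_labels ::
    "(nat \<times> 'a lgraph, (nat option \<Rightarrow> nat option) \<times> ('a name \<Rightarrow> 'a name),
      'a ngraph, 'a name \<Rightarrow> 'a name) funct" where
  "forget_labels = \<lparr>OnOb = (\<lambda>(n, X). fst X),
     OnHom = (\<lambda>(n, X) _ (\<phi>, \<alpha>). \<lambda>e \<in> edges (fst X). \<alpha> (Old e))\<rparr>"

lemma forget_labels_simps:
  "OnOb forget_labels (n, X) = fst X"
  "OnHom forget_labels (n, X) Z (\<phi>, \<alpha>) = (\<lambda>e \<in> edges (fst X). \<alpha> (Old e))"
  by (simp_all add: forget_labels_def)

lemma forget_labels_bij:
  assumes "x \<in> Obj tree_groth" "y \<in> Obj tree_groth"
  shows "bij_betw (OnHom forget_labels x y) (Hom tree_groth x y)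
    (Hom Omega (OnOb forget_labels x) (OnOb forget_labels y))"
proof -
  obtain n X m Y where xy: "x = (n, X)" "y = (m, Y)" by (metis surj_pair)
  have X: "X \<in> Obj (labeled_trees n)" and Y: "Y \<in> Obj (labeled_trees m)"
    using assms by (simp_all add: xy groth_obj)
  have inj: "inj_on (OnHom forget_labels x y) (Hom tree_groth x y)"
  proof (rule inj_onI)
    fix p q assume p: "p \<in> Hom tree_groth x y" and q: "q \<in> Hom tree_groth x y"
      and eq: "OnHom forget_labels x y p = OnHom forget_labels x y q"
    obtain \<phi> \<alpha> \<phi>' \<alpha>' where pq: "p = (\<phi>, \<alpha>)" "q = (\<phi>', \<alpha>')" by fastforce
    have "\<alpha> (Old e) = \<alpha>' (Old e)" if "e \<in> edges (fst X)" for e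
      using fun_cong[OF eq, of e] that by (simp add: pq xy forget_labels_simps)
    then show "p = q"
      using graft_hom_eq[OF X Y, of \<phi> \<phi>' \<alpha> \<alpha>'] p q by (simp add: pq xy groth_hom)
  qed
  have "OnHom forget_labels x y p \<in> dend_hom (fst X) (fst Y)" if p: "p \<in> Hom tree_groth x y" for p
  proof -
    obtain \<phi> \<alpha> where pq: "p = (\<phi>, \<alpha>)" by fastforce
    then have h: "\<phi> \<in> Hom Fin_pt m n" "\<alpha> \<in> Hom (labeled_trees m) (graft m n \<phi> X) Y"
      using p by (simp_all add: xy groth_hom)
    then interpret grafting m n \<phi> X by unfold_locales (use X in auto)
    show ?thesis using hom_restrict[OF Y h(2)] by (simp add: pq xy forget_labels_simps)
  qed
  moreover have "f \<in> OnHom forget_labels x y ` Hom tree_groth x y"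
    if f: "f \<in> dend_hom (fst X) (fst Y)" for f
  proof -
    obtain \<phi> \<alpha> where "\<phi> \<in> Hom Fin_pt m n" "\<alpha> \<in> Hom (labeled_trees m) (graft m n \<phi> X) Y"
      "(\<lambda>e \<in> edges (fst X). \<alpha> (Old e)) = f"
      using graft_hom_ex[OF X Y f] .
    then show ?thesis
      by (intro image_eqI[of _ _ "(\<phi>, \<alpha>)"]) (simp_all add: xy groth_hom forget_labels_simps)
  qed
  ultimately have "OnHom forget_labels x y ` Hom tree_groth x y = dend_hom (fst X) (fst Y)" by blast
  with inj show ?thesis by (simp add: bij_betw_def Omega_def xy forget_labels_simps)
qed

lemma forget_labels_functor: "is_functor tree_groth Omega forget_labels"
proof (rule faithful_is_functor[OF Omega_category])
  fix x y :: "nat \<times> 'a lgraph" and p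
  assume xy: "x \<in> Obj tree_groth" "y \<in> Obj tree_groth"
  note bij = forget_labels_bij[OF xy]
  show "inj_on (OnHom forget_labels x y) (Hom tree_groth x y)" using bij by (rule bij_betw_imp_inj_on)
  show "OnHom forget_labels x y p \<in> Hom Omega (OnOb forget_labels x) (OnOb forget_labels y)"
    if "p \<in> Hom tree_groth x y" using bij that by (rule bij_betw_apply)
next
  fix x :: "nat \<times> 'a lgraph" assume x: "x \<in> Obj tree_groth"
  obtain n X where nX: "x = (n, X)" by (metis surj_pair)
  then have X: "X \<in> Obj (labeled_trees n)" using x by (simp add: groth_obj)
  show "OnOb forget_labels x \<in> Obj Omega"
    using X by (simp add: nX forget_labels_simps Omega_def obj_labeled)
  show "Idn tree_groth x \<in> Hom tree_groth x x"
    using tau_unit_hom[OF X] Idn_hom by (simp add: nX groth_idn groth_hom)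
  show "OnHom forget_labels x x (Idn tree_groth x) = Idn Omega (OnOb forget_labels x)"
    by (auto simp: nX groth_idn forget_labels_simps Omega_def)
next
  fix x y z :: "nat \<times> 'a lgraph" and p q
  assume obj: "x \<in> Obj tree_groth" "y \<in> Obj tree_groth" "z \<in> Obj tree_groth"
    and p: "p \<in> Hom tree_groth x y" and q: "q \<in> Hom tree_groth y z"
  obtain a X b Y c Z f \<alpha> g \<beta> where s: "x = (a, X)" "y = (b, Y)" "z = (c, Z)" "p = (f, \<alpha>)" "q = (g, \<beta>)"
    by (metis surj_pair)
  have X: "X \<in> Obj (labeled_trees a)" and Y: "Y \<in> Obj (labeled_trees b)" and Z: "Z \<in> Obj (labeled_trees c)"
    and f: "f \<in> Hom Fin_pt b a" "\<alpha> \<in> Hom (labeled_trees b) (graft b a f X) Y"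
    and g: "g \<in> Hom Fin_pt c b" "\<beta> \<in> Hom (labeled_trees c) (graft c b g Y) Z"
    using obj p q by (auto simp: s groth_obj groth_hom)
  have fg: "Cmp Fin_pt c b a f g \<in> Hom Fin_pt c a" by (rule Cmp_hom[OF g(1) f(1)])
  interpret A: grafting b a f X by unfold_locales (use X f in auto)
  interpret B: grafting c b g "graft b a f X" by unfold_locales (use A.graft_obj g in auto)
  interpret B': grafting c b g Y by unfold_locales (use Y g in auto)
  interpret C: grafting c a "Cmp Fin_pt c b a f g" X by unfold_locales (use X fg in auto)
  have cmp: "Cmp (labeled_trees c) U V W h k \<in> Hom (labeled_trees c) U W"
    if "U \<in> Obj (labeled_trees c)" "V \<in> Obj (labeled_trees c)" "W \<in> Obj (labeled_trees c)"
      "k \<in> Hom (labeled_trees c) U V" "h \<in> Hom (labeled_trees c) V W" for U V W :: "'a lgraph" and h k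
    using labeled_category[of c] that unfolding is_category_def by blast
  show "Cmp tree_groth x y z q p \<in> Hom tree_groth x z"
    unfolding s groth_cmp Let_def groth_hom
    by (intro conjI fg cmp[OF C.graft_obj B'.graft_obj Z _ g(2)]
        cmp[OF C.graft_obj B.graft_obj B'.graft_obj] tau_comp_hom X g(1) f(1) B.graft_map_hom Y f(2))
  \<comment> \<open>The composite takes \<open>Old e\<close> to \<open>Old (Old e)\<close> by
    \<open>tau_comp\<close>, then to \<open>Old (\<alpha> (Old e))\<close>, then applies
    \<open>\<beta>\<close>. This fact puts the intermediate values in the domains of the restricted
    functions.\<close>
  have "\<alpha> (Old e) \<in> edges (fst Y)" if "e \<in> edges (fst X)" for e
    using dend_hom_edge[of \<alpha> A.G "fst Y" "Old e"] f(2) that by (simp add: hom_labeled)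
  then show "OnHom forget_labels x z (Cmp tree_groth x y z q p) =
      Cmp Omega (OnOb forget_labels x) (OnOb forget_labels y) (OnOb forget_labels z)
        (OnHom forget_labels y z q) (OnHom forget_labels x y p)"
    by (auto simp: s groth_cmp Let_def cmp_labeled forget_labels_simps Omega_def compose_def fun_eq_iff)
qed

lemma labeling_exists:
  assumes "is_tree T"
  shows "\<exists>x. x \<in> Obj tree_groth \<and> OnOb forget_labels x = T"
proof -
  have "finite (leaves T)" using assms by (simp add: is_tree_def leaves_def)
  then obtain \<chi> where "bij_betw \<chi> {1..card (leaves T)} (leaves T)"
    using ex_bij_betw_nat_finite_1 by blast
  then have "bij_betw (restrict \<chi> {1..card (leaves T)}) {1..card (leaves T)} (leaves T)"
    by (simp add: bij_betw_restrict_eq)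
  then show ?thesis
    using assms by (intro exI[of _ "(card (leaves T), T, restrict \<chi> {1..card (leaves T)})"])
      (simp add: groth_obj obj_labeled forget_labels_simps)
qed

theorem theorem1p1:
  shows "is_oplax_functor Fin_pt
           (tree_oplax :: (nat, nat option \<Rightarrow> nat option, 'a lgraph, 'a name \<Rightarrow> 'a name) oplax_data)
       \<and> equivalent_categories
           (Omega :: ('a ngraph, 'a name \<Rightarrow> 'a name) cat)
           (grothendieck Fin_pt
             (tree_oplax :: (nat, nat option \<Rightarrow> nat option, 'a lgraph, 'a name \<Rightarrow> 'a name) oplax_data))"
proof
  show "is_oplax_functor Fin_pt
     (tree_oplax :: (nat, nat option \<Rightarrow> nat option, 'a lgraph, 'a name \<Rightarrow> 'a name) oplax_data)"
    by (rule tree_oplax)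
  let ?U = "forget_labels :: (nat \<times> 'a lgraph, _, 'a ngraph, _) funct"
  \<comment> \<open>Chooses a labeling of each tree; forgetting it returns the very same tree, so
    \<open>?S\<close> is a strict section on objects.\<close>
  let ?S = "\<lambda>T. SOME x. x \<in> Obj tree_groth \<and> OnOb ?U x = T"
  have S: "?S T \<in> Obj tree_groth \<and> OnOb ?U (?S T) = T" if "T \<in> Obj Omega" for T
    using someI_ex[OF labeling_exists] that by (simp add: Omega_def)
  show "equivalent_categories (Omega :: ('a ngraph, 'a name \<Rightarrow> 'a name) cat)
      (tree_groth :: (nat \<times> 'a lgraph, _) cat)"
  proof (rule equivalent_if_fully_faithful[where U = ?U and S = ?S])
    show "is_functor tree_groth Omega ?U" by (rule forget_labels_functor)
    show "bij_betw (OnHom ?U x y) (Hom tree_groth x y) (Hom Omega (OnOb ?U x) (OnOb ?U y))"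
      if "x \<in> Obj tree_groth" "y \<in> Obj tree_groth" for x y
      using forget_labels_bij that .
    show "?S T \<in> Obj tree_groth" "OnOb ?U (?S T) = T" if "T \<in> Obj Omega" for T
      using S[OF that] by auto
  qed
qed

end
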